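(* Assume A1, A2 and A3(D). Let $\beta\in[0,1)$ and let the learning rate satisfy $$0<\eta<\frac{2N}{\sigma_{\max}^2\,H_{\ell^{-1}(N\mathcal{L}(w(1)))}}.$$ Then for almost every dataset $S$ and for every initialization $w(1)\in\mathbb{R}^d$, the GDM iterates satisfy: (i) $\sup_{t\ge1}\|w(t)-\ln(t)\,\hat w\|<\infty$; (ii) $\lim_{t\to\infty} w(t)/\|w(t)\|=\hat w/\|\hat w\|$.
   Context: Setting. The data are $S=\{x_1,\dots,x_N\}\subset\mathbb{R}^d$; labels have been absorbed, so each $x_i$ stands for $y_ix_i$. The empirical loss is $\mathcal{L}(w)=\frac1N\sum_{i=1}^N\ell(\langle w,x_i\rangle)$ for $w\in\mathbb{R}^d$. $\sigma_{\max}$ denotes the spectral norm of the $d\times N$ matrix $(x_1,\dots,x_N)$. Assumption A1 (separability): there is $w$ with $\langle w,x_i\rangle>0$ for all $i$. Assumption A2 (exponential tail): $\ell:\mathbb{R}\to\mathbb{R}$ is differentiable, $\ell'(x)<0$ for all $x$, $\lim_{x\to\infty}\ell(x)=\lim_{x\to\infty}\ell'(x)=0$, and $\limsup_{x\to-\infty}\ell'(x)<0$. Moreover there are positive constants $\mu_+,\mu_-,x_+,x_-$ such that $-\ell'(x)\le(1+e^{-\mu_+x})e^{-x}$ for $x>x_+$ and $-\ell'(x)\ge(1-e^{-\mu_-x})e^{-x}$ for $x>x_-$. Under A2, $\ell$ is a bijection from $\mathbb{R}$ onto $(0,\infty)$; $\ell^{-1}$ denotes its inverse. Assumption A3(D)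 (local smoothness): for every $s_0\in\mathbb{R}$ there is a finite constant $H_{s_0}>0$ with $|\ell'(x)-\ell'(y)|\le H_{s_0}|x-y|$ for all $x,y\ge s_0$. We take $H_{s_0}$ to be the smallest such constant. Max-margin solution: $\hat w=\arg\min\{\|w\|^2:\langle w,x_i\rangle\ge1\ \forall i\}$. "Almost every dataset" means: for all $(x_1,\dots,x_N)\in\mathbb{R}^{d\times N}$ outside a Lebesgue-null set (and satisfying A1). GDM (gradient descent with momentum): given $w(1)$, set $m(0)=0$ and, for $t\ge1$, $m(t)=\beta m(t-1)+(1-\beta)\nabla\mathcal{L}(w(t))$ and $w(t+1)=w(t)-\eta\,m(t)$. *)

theory Defs
  imports "HOL-Analysis.Analysis"
begin

text \<open>A dataset of N points in R^d (labels absorbed): an element of (real^'d)^'n,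
  i.e. N = CARD('n) points indexed by the finite type 'n, each in R^d = real^'d.\<close>

definition separable :: "(real^'d)^'n \<Rightarrow> bool" where
  "separable X \<longleftrightarrow> (\<exists>w. \<forall>i. inner w (X $ i) > 0)"

definition exp_tail_loss :: "(real \<Rightarrow> real) \<Rightarrow> bool" where
  "exp_tail_loss loss \<longleftrightarrow>
     (\<forall>x. loss differentiable at x) \<and>
     (\<forall>x. deriv loss x < 0) \<and>
     (loss \<longlongrightarrow> 0) at_top \<and> (deriv loss \<longlongrightarrow> 0) at_top \<and>
     Limsup at_bot (\<lambda>x. ereal (deriv loss x)) < 0 \<and>
     (\<exists>\<mu>p \<mu>m xp xm. \<mu>p > 0 \<and> \<mu>m > 0 \<and> xp > 0 \<and> xm > 0 \<and>
        (\<forall>x>xp. - deriv loss x \<le> (1 + exp (- \<mu>p * x)) * exp (- x)) \<and>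
        (\<forall>x>xm. - deriv loss x \<ge> (1 - exp (- \<mu>m * x)) * exp (- x)))"

definition locally_smooth_loss :: "(real \<Rightarrow> real) \<Rightarrow> bool" where
  "locally_smooth_loss loss \<longleftrightarrow> (\<forall>s0. \<exists>H>0. H-lipschitz_on {s0..} (deriv loss))"

definition smooth_const :: "(real \<Rightarrow> real) \<Rightarrow> real \<Rightarrow> real" where
  "smooth_const loss s0 = Inf {H. H-lipschitz_on {s0..} (deriv loss)}"

definition emp_loss :: "(real \<Rightarrow> real) \<Rightarrow> (real^'d)^'n \<Rightarrow> real^'d \<Rightarrow> real" where
  "emp_loss loss X w = (1 / real CARD('n)) * (\<Sum>i\<in>UNIV. loss (inner w (X $ i)))"

definition emp_grad :: "(real \<Rightarrow> real) \<Rightarrow> (real^'d)^'n \<Rightarrow> real^'d \<Rightarrow> real^'d" where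
  "emp_grad loss X w = (1 / real CARD('n)) *\<^sub>R (\<Sum>i\<in>UNIV. deriv loss (inner w (X $ i)) *\<^sub>R X $ i)"

definition data_matrix :: "(real^'d)^'n \<Rightarrow> real^'n^'d" where
  "data_matrix X = (\<chi> j i. X $ i $ j)"

definition sigma_max :: "(real^'d)^'n \<Rightarrow> real" where
  "sigma_max X = onorm (\<lambda>v. data_matrix X *v v)"

definition max_margin :: "(real^'d)^'n \<Rightarrow> real^'d" where
  "max_margin X = (THE w. (\<forall>i. inner w (X $ i) \<ge> 1) \<and>
       (\<forall>v. (\<forall>i. inner v (X $ i) \<ge> 1) \<longrightarrow> (norm w)^2 \<le> (norm v)^2))"

end

theory Submission
  imports Defs
begin

text \<open>Along the iterates the energy \<open>L(w(t)) + c \<parallel>m(t - 1)\<parallel>\<^sup>2\<close> decreases by a multiple of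
  \<open>\<parallel>m(t)\<parallel>\<^sup>2\<close>, so momenta and gradients are square summable and, by separability, all margins tend
  to infinity. The sequence \<open>z(t) = w(t) + \<beta>/(1 - \<beta>) (w(t) - w(t - 1))\<close> makes plain gradient steps with
  the gradient taken at \<open>w(t)\<close>. If the max-margin vector is \<open>h = \<Sum>v\<^sub>i x\<^sub>i\<close> with \<open>v\<^sub>i > 0\<close> exactly on the
  support vectors, and \<open>u\<close> satisfies \<open>(\<eta>/N) exp(-\<langle>u, x\<^sub>i\<rangle>) = v\<^sub>i\<close> there, then for
  \<open>r(t) = z(t) - ln t h - u\<close> each data point contributes at most a summable amount to the increments of
  \<open>\<parallel>r(t)\<parallel>\<^sup>2\<close>, because \<open>(exp(-\<rho>) - 1) \<rho> \<le> 0\<close>; hence \<open>r\<close> stays bounded. Datasets for which \<open>v\<close> or \<open>u\<close>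
  does not exist lie in countably many closed sets that each meet every line parallel to some
  coordinate axis at most once.\<close>

section \<open>Losses with exponential tails\<close>

lemma exp_tail_loss_has_derivative:
  assumes "exp_tail_loss loss"
  shows "(loss has_real_derivative deriv loss x) (at x)"
  using assms unfolding exp_tail_loss_def
  by (simp add: DERIV_deriv_iff_real_differentiable)

lemma exp_tail_loss_less_iff:
  assumes "exp_tail_loss loss"
  shows "loss y < loss x \<longleftrightarrow> x < y"
proof -
  have *: "loss b < loss a" if "a < b" for a b
    using DERIV_neg_imp_decreasing[OF that, of loss] exp_tail_loss_has_derivative[OF assms] assms
    unfolding exp_tail_loss_def by blast
  show ?thesis
    using *[of x y] *[of y x] by (cases x y rule: linorder_cases) auto
qed

lemma exp_tail_loss_pos:
  assumes "exp_tail_loss loss"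
  shows "0 < loss x"
proof -
  have "eventually (\<lambda>y. loss y \<le> loss (x + 1)) at_top"
    using eventually_ge_at_top[of "x + 1"]
    by eventually_elim (use exp_tail_loss_less_iff[OF assms] in \<open>meson not_le\<close>)
  then have "0 \<le> loss (x + 1)"
    using assms unfolding exp_tail_loss_def
    by (intro tendsto_upperbound[of loss 0 at_top]) auto
  also have "\<dots> < loss x"
    using exp_tail_loss_less_iff[OF assms] by simp
  finally show ?thesis .
qed

text \<open>The negative upper limit of the slope at minus infinity keeps the slope below some
  \<open>c < 0\<close> on a left half-line, so the loss grows at least linearly there.\<close>

lemma exp_tail_loss_unbounded:
  assumes "exp_tail_loss loss"
  shows "\<exists>x. y \<le> loss x"
proof -
  have "Limsup at_bot (\<lambda>x. ereal (deriv loss x)) < 0"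
    using assms unfolding exp_tail_loss_def by blast
  then obtain c where c: "Limsup at_bot (\<lambda>x. ereal (deriv loss x)) < ereal c" "c < 0"
    using ereal_dense2 by (metis ereal_less(2) ereal_less_eq(3) less_ereal.simps(1) zero_ereal_def)
  from Limsup_lessD[OF c(1)] obtain M where M: "\<And>x. x \<le> M \<Longrightarrow> deriv loss x < c"
    by (auto simp: eventually_at_bot_linorder)
  \<comment> \<open>Far enough to the left of \<open>M\<close> that a slope below \<open>c\<close>
    gains \<open>y - loss M\<close>; the minimum covers the case where nothing has to be
    gained.\<close>
  define x where "x = min M (M - (y - loss M) / (- c))"
  have "loss M - c * M \<le> loss x - c * x"
  proof (rule DERIV_nonpos_imp_nonincreasing[where f = "\<lambda>x. loss x - c * x"])
    show "x \<le> M" by (simp add: x_def)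
    fix z assume "x \<le> z" "z \<le> M"
    then show "\<exists>d. ((\<lambda>x. loss x - c * x) has_real_derivative d) (at z) \<and> d \<le> 0"
      using M[of z]
      by (intro exI[of _ "deriv loss z - c"] conjI)
         (auto intro!: derivative_eq_intros exp_tail_loss_has_derivative[OF assms])
  qed
  moreover have "(M - x) * (- c) \<ge> y - loss M"
    using c(2) unfolding x_def by (simp add: min_def field_simps split: if_splits)
  ultimately have "y \<le> loss x" by (simp add: algebra_simps)
  then show ?thesis ..
qed

text \<open>\<open>the_inv\<close> is meaningful only on the range, so membership of
  \<open>y\<close> has to be shown: \<open>x0\<close> and a point of larger loss bracket it for the
  intermediate value theorem.\<close>

lemma exp_tail_loss_the_inv:
  assumes "exp_tail_loss loss" "loss x0 \<le> y"
  shows "loss (the_inv loss y) = y"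
proof -
  obtain x where x: "y \<le> loss x"
    using exp_tail_loss_unbounded[OF assms(1)] by blast
  have "loss x0 \<le> loss x"
    using assms(2) x by simp
  then have "x \<le> x0"
    using exp_tail_loss_less_iff[OF assms(1)] by (meson not_le)
  then obtain s where s: "loss s = y"
    using IVT2[of loss x0 y x] x assms(2) exp_tail_loss_has_derivative[OF assms(1)]
    by (blast intro: DERIV_isCont)
  have "inj loss"
    using exp_tail_loss_less_iff[OF assms(1)] by (metis injI linorder_cases less_irrefl)
  then show ?thesis
    using s by (metis the_inv_f_f)
qed

text \<open>Continuing the loss linearly to the left of \<open>s0\<close> makes it globally smooth. A step that
  does not increase the continued empirical loss cannot leave the region where it agrees with the
  original one, so no separate argument is needed for the segment between two iterates.\<close>

definition lin_ext :: "(real \<Rightarrow> real) \<Rightarrow> real \<Rightarrow> real \<Rightarrow> real" where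
  "lin_ext loss s0 x = (if s0 \<le> x then loss x else loss s0 + deriv loss s0 * (x - s0))"

lemma lin_ext_ge:
  assumes "exp_tail_loss loss"
  shows "lin_ext loss s0 x > 0" and "lin_ext loss s0 x \<le> loss s0 \<Longrightarrow> s0 \<le> x"
proof -
  have *: "deriv loss s0 * (x - s0) > 0" if "x < s0"
    using that assms unfolding exp_tail_loss_def by (simp add: mult_neg_neg)
  show "lin_ext loss s0 x > 0"
    using * exp_tail_loss_pos[OF assms, of s0] exp_tail_loss_pos[OF assms, of x]
    by (auto simp: lin_ext_def)
  show "s0 \<le> x" if "lin_ext loss s0 x \<le> loss s0"
    using that * by (auto simp: lin_ext_def split: if_splits)
qed

text \<open>Right of \<open>s0\<close>, the gap \<open>h\<close> between the quadratic model and the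
  loss vanishes at \<open>u\<close>, decreases before it and increases after it. Left of
  \<open>s0\<close>, the model is compared with the tangent at \<open>s0\<close>.\<close>

lemma lin_ext_descent:
  assumes loss: "exp_tail_loss loss" and H: "H-lipschitz_on {s0..} (deriv loss)" and u: "s0 \<le> u"
  shows "lin_ext loss s0 v \<le> loss u + deriv loss u * (v - u) + H / 2 * (v - u)\<^sup>2"
proof -
  have lip: "\<bar>deriv loss x - deriv loss y\<bar> \<le> H * \<bar>x - y\<bar>" if "s0 \<le> x" "s0 \<le> y" for x y
    using lipschitz_onD[OF H, of x y] that by (simp add: dist_real_def)
  define h where "h v = loss u + deriv loss u * (v - u) + H / 2 * (v - u)\<^sup>2 - loss v" for v
  have der: "(h has_real_derivative deriv loss u + H * (z - u) - deriv loss z) (at z)" for z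
    unfolding h_def
    by (auto intro!: derivative_eq_intros exp_tail_loss_has_derivative[OF loss])
  have h: "0 \<le> h z" if "s0 \<le> z" for z
  proof (cases "u \<le> z")
    case True
    have "h u \<le> h z"
    proof (rule DERIV_nonneg_imp_nondecreasing[OF True])
      fix x assume "u \<le> x" "x \<le> z"
      then have "0 \<le> deriv loss u + H * (x - u) - deriv loss x"
        using lip[of u x] u by auto
      with der show "\<exists>y. (h has_real_derivative y) (at x) \<and> 0 \<le> y" by blast
    qed
    then show ?thesis by (simp add: h_def)
  next
    case False
    have "h z \<ge> h u"
    proof (rule DERIV_nonpos_imp_nonincreasing[of z u h], goal_cases)
      case (2 x)
      then have "deriv loss u + H * (x - u) - deriv loss x \<le> 0"
        using lip[of u x] u that by (auto simp: algebra_simps)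
      with der show ?case by blast
    qed (use False in auto)
    then show ?thesis by (simp add: h_def)
  qed
  show ?thesis
  proof (cases "s0 \<le> v")
    case True
    then show ?thesis using h[OF True] by (simp add: lin_ext_def h_def)
  next
    case False
    \<comment> \<open>Expanding \<open>(v - u)\<^sup>2\<close> around \<open>s0\<close>, the gap at
      \<open>v\<close> equals \<open>h s0\<close>, plus right side minus left side of this
      inequality, plus \<open>H / 2 * (s0 - v)\<^sup>2\<close>.\<close>
    have "(deriv loss u - deriv loss s0) * (s0 - v) \<le> (H * (u - s0)) * (s0 - v)"
      using lip[of u s0] u False by (intro mult_right_mono) auto
    moreover have "0 \<le> H * (s0 - v)\<^sup>2"
      using lipschitz_on_nonneg[OF H] by simp
    ultimately show ?thesis
      using h[of s0] False by (simp add: lin_ext_def h_def power2_eq_square field_simps)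
  qed
qed

text \<open>Strictness of the learning-rate bound leaves room for a Lipschitz constant
  \<open>H\<close> slightly above the infimum, which avoids showing that the infimum is
  attained.\<close>

lemma smooth_const_lipschitzE:
  assumes "locally_smooth_loss loss" "0 < \<eta>" "\<eta> < a / (b * smooth_const loss s0)" "0 \<le> b" "0 < a"
  obtains H where "H-lipschitz_on {s0..} (deriv loss)" "\<eta> * (b * H) < a"
proof -
  let ?S = "{H. H-lipschitz_on {s0..} (deriv loss)}"
  have ne: "?S \<noteq> {}" using assms(1) unfolding locally_smooth_loss_def by blast
  have nonneg: "0 \<le> smooth_const loss s0" unfolding smooth_const_def
    using ne by (intro cInf_greatest) (auto dest: lipschitz_on_nonneg)
  \<comment> \<open>Division by zero gives 0, which would contradict \<open>0 < \<eta>\<close> and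
    the upper bound on \<open>\<eta>\<close>; hence the denominator is positive.\<close>
  have pos: "0 < b" "0 < smooth_const loss s0"
    using assms nonneg by (auto simp: less_le)
  then have "Inf ?S < a / (b * \<eta>)"
    using assms unfolding smooth_const_def[symmetric] by (simp add: field_simps)
  then obtain H where H: "H \<in> ?S" "H < a / (b * \<eta>)"
    using cInf_lessD[OF ne] by blast
  have "smooth_const loss s0 \<le> H"
    unfolding smooth_const_def using H(1)
    by (intro cInf_lower) (auto simp: bdd_below_def dest: lipschitz_on_nonneg)
  with H pos assms that show thesis by (simp add: field_simps)
qed

section \<open>Energy decay for momentum iterates\<close>

text \<open>The vector \<open>y\<close> of margins is the transposed data matrix applied to
  \<open>v\<close>. Its squared norm is the inner product of \<open>v\<close> with the data matrix
  applied to \<open>y\<close>, so Cauchy-Schwarz and the operator norm give the bound after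
  cancelling \<open>norm y\<close>.\<close>

lemma sum_inner_power2_le_sigma_max:
  fixes X :: "(real^'d)^'n"
  shows "(\<Sum>i\<in>UNIV. (inner v (X $ i))\<^sup>2) \<le> (sigma_max X)\<^sup>2 * (norm v)\<^sup>2"
proof -
  define y where "y = (\<chi> i. inner v (X $ i))"
  have yy: "inner y y = (\<Sum>i\<in>UNIV. (inner v (X $ i))\<^sup>2)"
    by (simp add: y_def inner_vec_def power2_eq_square)
  have bl: "bounded_linear (\<lambda>u. data_matrix X *v u)"
    by (rule matrix_vector_mul_bounded_linear)
  have "inner v (data_matrix X *v y) = (\<Sum>j\<in>UNIV. \<Sum>i\<in>UNIV. v $ j * (X $ i $ j * y $ i))"
    by (simp add: inner_vec_def matrix_vector_mult_def data_matrix_def sum_distrib_left)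
  also have "\<dots> = (\<Sum>i\<in>UNIV. \<Sum>j\<in>UNIV. v $ j * (X $ i $ j * y $ i))"
    by (rule sum.swap)
  also have "\<dots> = (\<Sum>i\<in>UNIV. inner v (X $ i) * y $ i)"
    by (simp add: inner_vec_def[of v] sum_distrib_left mult_ac)
  also have "\<dots> = inner y y"
    unfolding inner_vec_def[of y y] by (simp add: y_def)
  finally have "(norm y)\<^sup>2 = inner v (data_matrix X *v y)"
    by (simp add: power2_norm_eq_inner)
  also have "\<dots> \<le> norm v * norm (data_matrix X *v y)"
    by (rule norm_cauchy_schwarz)
  also have "\<dots> \<le> norm v * (sigma_max X * norm y)"
    unfolding sigma_max_def using onorm[OF bl] by (intro mult_left_mono) auto
  finally have *: "norm y * norm y \<le> (sigma_max X * norm v) * norm y"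
    by (simp add: power2_eq_square mult_ac)
  have "0 \<le> sigma_max X"
    unfolding sigma_max_def by (rule onorm_pos_le[OF bl])
  then have "norm y \<le> sigma_max X * norm v"
    using * by (cases "y = 0") auto
  then have "(norm y)\<^sup>2 \<le> (sigma_max X * norm v)\<^sup>2"
    by (rule power_mono) simp
  then show ?thesis
    by (simp add: yy[symmetric] power2_norm_eq_inner[symmetric] power_mult_distrib)
qed

text \<open>Sum of the one-dimensional quadratic bounds. The target \<open>v\<close> is
  unrestricted, hence the extended loss on the left and the original one at
  \<open>u\<close>.\<close>

lemma emp_loss_descent:
  fixes X :: "(real^'d)^'n"
  assumes "exp_tail_loss loss" and lip: "H-lipschitz_on {s0..} (deriv loss)"
    and "\<And>i. s0 \<le> inner u (X $ i)"
  shows "(1 / real CARD('n)) * (\<Sum>i\<in>UNIV. lin_ext loss s0 (inner v (X $ i)))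
    \<le> emp_loss loss X u + inner (emp_grad loss X u) (v - u)
       + (sigma_max X)\<^sup>2 * H / (2 * real CARD('n)) * (norm (v - u))\<^sup>2"
proof -
  let ?N = "real CARD('n)"
  have "(\<Sum>i\<in>UNIV. lin_ext loss s0 (inner v (X $ i)))
      \<le> (\<Sum>i\<in>UNIV. loss (inner u (X $ i)) + deriv loss (inner u (X $ i)) * inner (v - u) (X $ i)
          + H / 2 * (inner (v - u) (X $ i))\<^sup>2)"
    using lin_ext_descent[OF assms(1,2,3)]
    by (intro sum_mono) (simp add: inner_diff_left)
  also have "\<dots> = (\<Sum>i\<in>UNIV. loss (inner u (X $ i)))
      + (\<Sum>i\<in>UNIV. deriv loss (inner u (X $ i)) * inner (v - u) (X $ i))
      + H / 2 * (\<Sum>i\<in>UNIV. (inner (v - u) (X $ i))\<^sup>2)"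
    by (simp add: sum.distrib sum_distrib_left)
  also have "\<dots> \<le> (\<Sum>i\<in>UNIV. loss (inner u (X $ i)))
      + (\<Sum>i\<in>UNIV. deriv loss (inner u (X $ i)) * inner (v - u) (X $ i))
      + H / 2 * ((sigma_max X)\<^sup>2 * (norm (v - u))\<^sup>2)"
    using lipschitz_on_nonneg[OF lip]
    by (intro add_left_mono mult_left_mono sum_inner_power2_le_sigma_max) auto
  also have "\<dots> = ?N * (emp_loss loss X u + inner (emp_grad loss X u) (v - u)
       + (sigma_max X)\<^sup>2 * H / (2 * ?N) * (norm (v - u))\<^sup>2)"
    by (simp add: emp_loss_def emp_grad_def inner_commute[of _ "v - u"]
        inner_sum_right field_simps)
  finally have "(\<Sum>i\<in>UNIV. lin_ext loss s0 (inner v (X $ i))) \<le> \<dots>" .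
  then show ?thesis by (simp only: pos_divide_le_eq zero_less_card_finite of_nat_0_less_iff
      mult_1 times_divide_eq_left mult.commute)
qed

lemma lin_ext_sum_le_imp_ge:
  assumes "exp_tail_loss loss" "(\<Sum>i\<in>UNIV. lin_ext loss s0 (f i)) \<le> loss s0"
  shows "s0 \<le> f (i :: 'n::finite)"
proof -
  have "lin_ext loss s0 (f i) \<le> (\<Sum>i\<in>UNIV. lin_ext loss s0 (f i))"
    using lin_ext_ge(1)[OF assms(1)] by (intro member_le_sum) (auto intro: less_imp_le)
  then show ?thesis using lin_ext_ge(2)[OF assms(1)] assms(2) by (meson order_trans)
qed

text \<open>The iterates are indexed from 0 here, so \<open>W n\<close> is the informal \<open>w(n+1)\<close>, while \<open>M n\<close> is
  \<open>m(n)\<close>.\<close>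

locale gdm_run =
  fixes loss :: "real \<Rightarrow> real" and X :: "(real^'d)^'n" and \<beta> \<eta> s0 H :: real
    and W M :: "nat \<Rightarrow> real^'d"
  assumes loss: "exp_tail_loss loss"
    and lip: "H-lipschitz_on {s0..} (deriv loss)"
    and \<beta>: "0 \<le> \<beta>" "\<beta> < 1"
    and \<eta>: "0 < \<eta>" "\<eta> * ((sigma_max X)\<^sup>2 * H) < 2 * real CARD('n)"
    and s0: "loss s0 = real CARD('n) * emp_loss loss X (W 0)"
    and M_0: "M 0 = 0"
    and M_Suc: "M (Suc n) = \<beta> *\<^sub>R M n + (1 - \<beta>) *\<^sub>R emp_grad loss X (W n)"
    and W_Suc: "W (Suc n) = W n - \<eta> *\<^sub>R M (Suc n)"
begin

text \<open>The weight of the momentum is exactly what the cross term between consecutive momenta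
  leaves behind after it is split into squares.\<close>

definition energy :: "nat \<Rightarrow> real" where
  "energy n = emp_loss loss X (W n) + \<beta> * \<eta> / (2 * (1 - \<beta>)) * (norm (M n))\<^sup>2"

text \<open>Net coefficient of the squared new momentum: \<open>\<eta>\<close> gained from the
  gradient term, minus the curvature cost of a step of length \<open>\<eta>\<close> times the
  momentum.\<close>

definition decay :: real where
  "decay = \<eta> - (sigma_max X)\<^sup>2 * H / (2 * real CARD('n)) * \<eta>\<^sup>2"

lemma decay_pos: "0 < decay"
proof -
  have "\<eta> * (\<eta> * ((sigma_max X)\<^sup>2 * H)) < \<eta> * (2 * real CARD('n))"
    using \<eta> by (intro mult_strict_left_mono) auto
  then show ?thesis by (simp add: decay_def field_simps power2_eq_square)
qed

lemma energy_nonneg: "0 \<le> energy n"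
  unfolding energy_def emp_loss_def using \<beta> \<eta> exp_tail_loss_pos[OF loss]
  by (intro add_nonneg_nonneg mult_nonneg_nonneg sum_nonneg) (auto intro: less_imp_le)

lemma grad_eq: "emp_grad loss X (W n) = (1 / (1 - \<beta>)) *\<^sub>R (M (Suc n) - \<beta> *\<^sub>R M n)"
  using \<beta> by (simp add: M_Suc)

text \<open>Writing the gradient through two consecutive momenta, its inner product with the new one
  contains a single cross term, bounded by the mean of the two squares. The descent bound is first
  obtained for the extended loss and only then transferred.\<close>

lemma energy_step:
  assumes reg: "\<And>i. s0 \<le> inner (W n) (X $ i)" and le: "energy n \<le> energy 0"
  shows "\<And>i. s0 \<le> inner (W (Suc n)) (X $ i)"
    and "energy (Suc n) \<le> energy n - decay * (norm (M (Suc n)))\<^sup>2"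
proof -
  let ?N = "real CARD('n)"
  define L where "L = (1 / ?N) * (\<Sum>i\<in>UNIV. lin_ext loss s0 (inner (W (Suc n)) (X $ i)))"
  define Q where "Q = (sigma_max X)\<^sup>2 * H / (2 * ?N)"
  define P where "P = \<beta> / (2 * (1 - \<beta>))"
  let ?m = "M n" and ?m' = "M (Suc n)"
  have "L \<le> emp_loss loss X (W n) + inner (emp_grad loss X (W n)) (- \<eta> *\<^sub>R ?m')
      + Q * (norm (- \<eta> *\<^sub>R ?m'))\<^sup>2"
    using emp_loss_descent[OF loss lip reg, of "W (Suc n)"] unfolding L_def Q_def W_Suc by simp
  then have 1: "L \<le> emp_loss loss X (W n) - \<eta> * inner (emp_grad loss X (W n)) ?m'
      + Q * \<eta>\<^sup>2 * (norm ?m')\<^sup>2"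
    by (simp add: power_mult_distrib)
  have g: "inner (emp_grad loss X (W n)) ?m' = ((norm ?m')\<^sup>2 - \<beta> * inner ?m ?m') / (1 - \<beta>)"
    by (simp add: grad_eq inner_diff_left power2_norm_eq_inner)
  have "2 * inner ?m ?m' \<le> (norm ?m)\<^sup>2 + (norm ?m')\<^sup>2"
    using zero_le_power2[of "norm (?m - ?m')"]
    by (simp add: power2_norm_eq_inner inner_diff_left inner_diff_right inner_commute)
  then have y: "\<beta> * (2 * inner ?m ?m') \<le> \<beta> * ((norm ?m)\<^sup>2 + (norm ?m')\<^sup>2)"
    using \<beta> by (intro mult_left_mono) auto
  \<comment> \<open>With the denominator \<open>1 - \<beta>\<close> cleared, \<open>P\<close>
    satisfies \<open>P * (1 - \<beta>) = \<beta> / 2\<close>.\<close>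
  have z: "((1 + P) * a - P * b) * (1 - \<beta>) = (1 - \<beta>) * a + \<beta> / 2 * a - \<beta> / 2 * b" for a b
  proof -
    have "P * (1 - \<beta>) = \<beta> / 2" using \<beta> by (simp add: P_def field_simps)
    then have "P * (1 - \<beta>) * (a - b) = \<beta> / 2 * (a - b)" by (rule arg_cong)
    then have "(P - P * \<beta>) * (a - b) = \<beta> / 2 * (a - b)" by (simp only: right_diff_distrib mult_1_right)
    then show ?thesis by (simp add: algebra_simps)
  qed
  have "((1 + P) * (norm ?m')\<^sup>2 - P * (norm ?m)\<^sup>2) * (1 - \<beta>)
      \<le> (norm ?m')\<^sup>2 - \<beta> * inner ?m ?m'"
    unfolding z using y by (simp add: algebra_simps)
  then have "(1 + P) * (norm ?m')\<^sup>2 - P * (norm ?m)\<^sup>2 \<le> inner (emp_grad loss X (W n)) ?m'"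
    unfolding g using \<beta> by (simp only: pos_le_divide_eq diff_gt_0_iff_gt)
  then have 2: "\<eta> * ((1 + P) * (norm ?m')\<^sup>2 - P * (norm ?m)\<^sup>2)
      \<le> \<eta> * inner (emp_grad loss X (W n)) ?m'"
    using \<eta> by (intro mult_left_mono) auto
  have P: "0 \<le> P * \<eta> * (norm ?m')\<^sup>2" using \<beta> \<eta> by (simp add: P_def)
  have E: "energy k = emp_loss loss X (W k) + P * \<eta> * (norm (M k))\<^sup>2" for k
    by (simp add: energy_def P_def)
  \<comment> \<open>Still a statement about the extended loss: the new iterate is not yet known to
    stay in the region where the two losses agree.\<close>
  have 3: "L + P * \<eta> * (norm ?m')\<^sup>2 \<le> energy n - decay * (norm ?m')\<^sup>2"
    using 1 2 unfolding E decay_def Q_def[symmetric] by (simp add: algebra_simps)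
  moreover have "0 \<le> decay * (norm ?m')\<^sup>2" using decay_pos by simp
  ultimately have "L \<le> energy 0"
    using le P by linarith
  \<comment> \<open>Since \<open>M 0 = 0\<close>, the initial energy is the initial loss, which is
    \<open>loss s0 / N\<close> by the choice of \<open>s0\<close>.\<close>
  then have "(\<Sum>i\<in>UNIV. lin_ext loss s0 (inner (W (Suc n)) (X $ i))) \<le> loss s0"
    unfolding s0 by (simp add: energy_def M_0 L_def field_simps)
  then show reg': "s0 \<le> inner (W (Suc n)) (X $ i)" for i
    by (rule lin_ext_sum_le_imp_ge[OF loss])
  then have "L = emp_loss loss X (W (Suc n))"
    by (simp add: L_def emp_loss_def lin_ext_def)
  with 3 show "energy (Suc n) \<le> energy n - decay * (norm (M (Suc n)))\<^sup>2"
    by (simp add: E)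
qed

text \<open>Both claims go through one induction, since each step of the energy estimate consumes
  both.\<close>

lemma inner_W_ge_energy_le: "(\<forall>i. s0 \<le> inner (W n) (X $ i)) \<and> energy n \<le> energy 0"
proof (induction n)
  case 0
  have "loss (inner (W 0) (X $ i)) \<le> loss s0" for i
    using member_le_sum[of i UNIV "\<lambda>i. loss (inner (W 0) (X $ i))"] exp_tail_loss_pos[OF loss]
    by (simp add: s0 emp_loss_def less_imp_le)
  then show ?case using exp_tail_loss_less_iff[OF loss] by (metis not_le order_refl)
next
  case (Suc n)
  have "0 \<le> decay * (norm (M (Suc n)))\<^sup>2" using decay_pos by simp
  moreover have "energy (Suc n) \<le> energy n - decay * (norm (M (Suc n)))\<^sup>2"
    using energy_step(2)[of n] Suc by blast
  ultimately have "energy (Suc n) \<le> energy 0" using Suc by linarith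
  then show ?case using energy_step(1)[of n] Suc by blast
qed

lemma inner_W_ge: "s0 \<le> inner (W n) (X $ i)"
  using inner_W_ge_energy_le by blast

section \<open>Square summability and divergence of the margins\<close>

text \<open>The energy drops telescope, and the energy is bounded below by 0.\<close>

lemma summable_M: "summable (\<lambda>n. (norm (M n))\<^sup>2)"
proof -
  have "decay * (\<Sum>k<n. (norm (M (Suc k)))\<^sup>2) \<le> energy 0 - energy n" for n
  proof (induction n)
    case (Suc n)
    then show ?case
      using energy_step(2)[of n] inner_W_ge_energy_le[of n] by (simp add: algebra_simps)
  qed simp
  then have "decay * (\<Sum>k<n. (norm (M (Suc k)))\<^sup>2) \<le> energy 0" for n
    using energy_nonneg[of n] by (smt (verit))
  then have "(\<Sum>k<n. (norm (M (Suc k)))\<^sup>2) \<le> energy 0 / decay" for n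
    using decay_pos by (simp add: field_simps)
  then have "summable (\<lambda>n. (norm (M (Suc n)))\<^sup>2)"
    by (intro summableI_nonneg_bounded) auto
  then show ?thesis by (rule iffD1[OF summable_Suc_iff])
qed

lemma M_tendsto_0: "M \<longlonglongrightarrow> 0"
proof -
  have "(\<lambda>n. sqrt ((norm (M n))\<^sup>2)) \<longlonglongrightarrow> sqrt 0"
    by (intro tendsto_real_sqrt summable_LIMSEQ_zero[OF summable_M])
  then show ?thesis by (simp add: tendsto_norm_zero_iff)
qed

lemma summable_grad: "summable (\<lambda>n. (norm (emp_grad loss X (W n)))\<^sup>2)"
proof (rule summable_comparison_test')
  show "summable (\<lambda>n. (2 / (1 - \<beta>)\<^sup>2) * ((norm (M (Suc n)))\<^sup>2 + \<beta>\<^sup>2 * (norm (M n))\<^sup>2))"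
    using summable_M iffD2[OF summable_Suc_iff summable_M] by (intro summable_mult summable_add)
  fix n :: nat
  have "norm (M (Suc n) - \<beta> *\<^sub>R M n) \<le> norm (M (Suc n)) + \<beta> * norm (M n)"
    using norm_triangle_ineq4[of "M (Suc n)" "\<beta> *\<^sub>R M n"] \<beta> by simp
  then have "(norm (M (Suc n) - \<beta> *\<^sub>R M n))\<^sup>2 \<le> (norm (M (Suc n)) + \<beta> * norm (M n))\<^sup>2"
    by (intro power_mono) auto
  also have "\<dots> \<le> 2 * ((norm (M (Suc n)))\<^sup>2 + (\<beta> * norm (M n))\<^sup>2)"
    using sum_squares_bound[of "norm (M (Suc n))" "\<beta> * norm (M n)"] by (simp add: power2_sum)
  finally have "(norm (M (Suc n) - \<beta> *\<^sub>R M n))\<^sup>2 / (1 - \<beta>)\<^sup>2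
      \<le> 2 * ((norm (M (Suc n)))\<^sup>2 + (\<beta> * norm (M n))\<^sup>2) / (1 - \<beta>)\<^sup>2"
    by (rule divide_right_mono) simp
  then show "norm ((norm (emp_grad loss X (W n)))\<^sup>2)
      \<le> (2 / (1 - \<beta>)\<^sup>2) * ((norm (M (Suc n)))\<^sup>2 + \<beta>\<^sup>2 * (norm (M n))\<^sup>2)"
    by (simp add: grad_eq power_divide power_mult_distrib)
qed

text \<open>Paired with a separating \<open>v\<close>, the gradient is a sum of terms of one sign,
  so its convergence to 0 sends every slope to 0. On a compact interval the slopes stay away from 0,
  so the margins must leave it, and \<open>s0\<close> blocks the exit on the left.\<close>

lemma inner_W_at_top:
  assumes "separable X"
  shows "filterlim (\<lambda>n. inner (W n) (X $ i)) at_top sequentially"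
proof -
  let ?N = "real CARD('n)" and ?l = "\<lambda>n i. deriv loss (inner (W n) (X $ i))"
  obtain v where v: "\<And>i. inner v (X $ i) > 0"
    using assms unfolding separable_def by blast
  have neg: "deriv loss x < 0" for x
    using loss unfolding exp_tail_loss_def by blast
  have "(\<lambda>n. sqrt ((norm (emp_grad loss X (W n)))\<^sup>2)) \<longlonglongrightarrow> sqrt 0"
    by (intro tendsto_real_sqrt summable_LIMSEQ_zero[OF summable_grad])
  then have "(\<lambda>n. emp_grad loss X (W n)) \<longlonglongrightarrow> 0"
    by (simp add: tendsto_norm_zero_iff)
  then have "(\<lambda>n. - ?N * inner (emp_grad loss X (W n)) v / inner v (X $ i))
      \<longlonglongrightarrow> - ?N * inner 0 v / inner v (X $ i)"
    using v[of i] by (intro tendsto_intros) auto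
  then have lim: "(\<lambda>n. - ?N * inner (emp_grad loss X (W n)) v / inner v (X $ i)) \<longlonglongrightarrow> 0"
    by simp
  have bound: "- ?l n i \<le> - ?N * inner (emp_grad loss X (W n)) v / inner v (X $ i)" for n
  proof -
    have "- ?l n i * inner v (X $ i) \<le> (\<Sum>j\<in>UNIV. - ?l n j * inner v (X $ j))"
      using neg v by (intro member_le_sum) (auto intro!: less_imp_le mult_neg_pos)
    also have "\<dots> = - ?N * inner (emp_grad loss X (W n)) v"
      by (simp add: emp_grad_def inner_sum_left inner_commute[of v] sum_negf)
    finally show ?thesis using v[of i] by (simp add: field_simps)
  qed
  show ?thesis
    unfolding filterlim_at_top
  proof
    fix B :: real
    define C where "C = {s0..max s0 B}"
    have "continuous_on C (deriv loss)"
      using lipschitz_on_continuous_on[OF lip] continuous_on_subset by (force simp: C_def)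
    then obtain y where y: "y \<in> C" "\<And>x. x \<in> C \<Longrightarrow> deriv loss x \<le> deriv loss y"
      using continuous_attains_sup[of C "deriv loss"] by (auto simp: C_def)
    have "eventually (\<lambda>n. - ?N * inner (emp_grad loss X (W n)) v / inner v (X $ i) < - deriv loss y)
        sequentially"
      using neg[of y] by (intro order_tendstoD(2)[OF lim]) simp
    then show "eventually (\<lambda>n. B \<le> inner (W n) (X $ i)) sequentially"
    proof eventually_elim
      case (elim n)
      then have "inner (W n) (X $ i) \<notin> C"
        using bound[of n] y(2)[of "inner (W n) (X $ i)"] by linarith
      then show ?case using inner_W_ge[of n i] by (auto simp: C_def)
    qed
  qed
qed

end

section \<open>Degenerate datasets and the max-margin vector\<close>

text \<open>The translates of a bounded piece \<open>D\<close> by \<open>b / (n + 1)\<close> are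
  pairwise disjoint, of equal measure, and lie in one bounded set. Infinitely many of them fit into
  finite measure only if \<open>D\<close> is null.\<close>

lemma null_sets_if_line_meets_once:
  fixes C :: "'a::euclidean_space set"
  assumes C: "C \<in> sets borel" and line: "\<And>x s. x \<in> C \<Longrightarrow> x + s *\<^sub>R b \<in> C \<Longrightarrow> s = 0"
  shows "C \<in> null_sets lborel"
proof -
  have bounded_null: "emeasure lborel D = 0" if D: "D \<subseteq> C" "bounded D" "D \<in> sets borel" for D
  proof -
    define T where "T n = (\<lambda>x. (1 / real (Suc n)) *\<^sub>R b + x) ` D" for n
    have T: "T n = (\<lambda>x. x - (1 / real (Suc n)) *\<^sub>R b) -` D \<inter> space borel" for n
      unfolding T_def by (force simp: image_iff)
    have meas: "T n \<in> sets borel" for n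
      unfolding T by (rule measurable_sets[OF _ D(3)]) measurable
    have eq: "emeasure lborel (T n) = emeasure lborel D" for n
    proof -
      have "emeasure lborel (T n) =
          emeasure (distr lborel borel ((+) ((1 / real (Suc n)) *\<^sub>R b))) (T n)"
        by (simp add: lborel_distr_plus)
      also have "\<dots> = emeasure lborel ((+) ((1 / real (Suc n)) *\<^sub>R b) -` T n \<inter> space lborel)"
        using meas by (subst emeasure_distr) auto
      also have "(+) ((1 / real (Suc n)) *\<^sub>R b) -` T n \<inter> space lborel = D"
        by (auto simp: T_def)
      finally show ?thesis .
    qed
    have disj: "disjoint_family T"
    proof (unfold disjoint_family_on_def, intro ballI impI, rule ccontr)
      fix m n :: nat assume "m \<noteq> n" "T m \<inter> T n \<noteq> {}"
      then obtain x y where xy: "x \<in> D" "y \<in> D"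
        "(1 / real (Suc m)) *\<^sub>R b + x = (1 / real (Suc n)) *\<^sub>R b + y"
        by (auto simp: T_def)
      then have "y = x + (1 / real (Suc m) - 1 / real (Suc n)) *\<^sub>R b"
        by (simp add: algebra_simps)
      with line[of x] xy D(1) have "1 / real (Suc m) - 1 / real (Suc n) = 0" by blast
      with \<open>m \<noteq> n\<close> show False by simp
    qed
    have "bounded (\<Union>n. T n)"
    proof -
      obtain B where B: "\<And>x. x \<in> D \<Longrightarrow> norm x \<le> B"
        using D(2) by (auto simp: bounded_iff)
      have "norm ((1 / real (Suc n)) *\<^sub>R b + x) \<le> norm b + B" if "x \<in> D" for x n
      proof -
        have "norm ((1 / real (Suc n)) *\<^sub>R b) \<le> norm b"
          by (simp add: divide_le_eq mult_le_cancel_left1)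
        then show ?thesis using B[OF that] by (meson add_mono norm_triangle_le order_trans)
      qed
      then show ?thesis
        by (auto simp: bounded_iff T_def)
    qed
    then have "emeasure lborel (\<Union>n. T n) < \<infinity>"
      by (rule emeasure_bounded_finite)
    moreover have "(\<Sum>n. emeasure lborel (T n)) = emeasure lborel (\<Union>n. T n)"
      by (rule suminf_emeasure) (use meas disj in auto)
    ultimately have fin: "(\<Sum>n::nat. emeasure lborel D) < \<infinity>" by (simp add: eq)
    have "emeasure lborel D < \<infinity>" using D(2) by (rule emeasure_bounded_finite)
    then obtain r where r: "emeasure lborel D = ennreal r" "0 \<le> r"
      by (cases "emeasure lborel D") auto
    have "summable (\<lambda>n::nat. r)"
      using fin r by (intro summable_suminf_not_top) (auto simp: less_top)
    then show ?thesis using r by (simp add: summable_const_iff)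
  qed
  have "C \<inter> ball 0 (real n) \<in> null_sets lborel" for n
    using C bounded_null[of "C \<inter> ball 0 (real n)"] bounded_Int by (intro null_setsI) auto
  then have "(\<Union>n. C \<inter> ball 0 (real n)) \<in> null_sets lborel"
    by (intro null_sets_UN')  auto
  moreover have "C = (\<Union>n. C \<inter> ball 0 (real n))"
    by (auto intro: reals_Archimedean2)
  ultimately show ?thesis by simp
qed

section \<open>Convex combinations of the data and degeneracy\<close>

definition prob_simplex :: "(real^'n) set" where
  "prob_simplex = {a. (\<forall>i. 0 \<le> a $ i) \<and> (\<Sum>i\<in>UNIV. a $ i) = 1}"

definition point_comb :: "(real^'d)^'n \<Rightarrow> real^'n \<Rightarrow> real^'d" where
  "point_comb X a = (\<Sum>i\<in>UNIV. a $ i *\<^sub>R X $ i)"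

lemma compact_prob_simplex: "compact (prob_simplex :: (real^'n) set)"
proof -
  have "bounded (prob_simplex :: (real^'n) set)"
  proof (rule bounded_subset)
    show "bounded (cbox (0 :: real^'n) 1)" by simp
    show "prob_simplex \<subseteq> cbox (0 :: real^'n) 1"
    proof
      fix a :: "real^'n" assume a: "a \<in> prob_simplex"
      have "a $ i \<le> 1" for i
        using member_le_sum[of i UNIV "\<lambda>i. a $ i"] a by (auto simp: prob_simplex_def)
      with a show "a \<in> cbox 0 1" by (auto simp: prob_simplex_def mem_box_cart)
    qed
  qed
  moreover have "closed (prob_simplex :: (real^'n) set)"
  proof -
    have eq: "prob_simplex = (\<Inter>i. {a::real^'n. 0 \<le> a $ i}) \<inter> {a. (\<Sum>i\<in>UNIV. a $ i) = 1}"
      by (auto simp: prob_simplex_def)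
    show ?thesis
      unfolding eq by (intro closed_INT closed_Int ballI closed_Collect_le closed_Collect_eq
          continuous_intros)
  qed
  ultimately show ?thesis by (simp add: compact_eq_bounded_closed)
qed

lemma inner_point_comb: "inner w (point_comb X a) = (\<Sum>i\<in>UNIV. a $ i * inner w (X $ i))"
  by (simp add: point_comb_def inner_sum_right)

lemma inner_point_comb_const:
  assumes "a \<in> prob_simplex" "\<And>j. a $ j \<noteq> 0 \<Longrightarrow> inner w (X $ j) = c"
  shows "inner w (point_comb X a) = c"
proof -
  have "inner w (point_comb X a) = (\<Sum>i\<in>UNIV. a $ i * c)"
    unfolding inner_point_comb using assms(2) by (intro sum.cong) auto
  also have "\<dots> = c"
    using assms(1) by (simp add: prob_simplex_def sum_distrib_right[symmetric])
  finally show ?thesis .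
qed

text \<open>A dataset is degenerate if some point orthogonal to a face of the convex hull of the data is
  a convex combination that omits one of the data points lying on that face; it is then either a
  support vector with vanishing multiplier or part of an affine dependence.\<close>

definition degenerate :: "(real^'d)^'n \<Rightarrow> bool" where
  "degenerate X \<longleftrightarrow> (\<exists>a\<in>prob_simplex. \<exists>i. point_comb X a \<noteq> 0 \<and> a $ i = 0 \<and>
     (\<forall>j. j = i \<or> a $ j \<noteq> 0 \<longrightarrow> inner (point_comb X a) (X $ j) = (norm (point_comb X a))\<^sup>2))"

text \<open>With the set of contributing points fixed, the combination is the point of smallest norm of
  their affine hull, hence unique.\<close>

lemma point_comb_unique:
  assumes a: "a \<in> prob_simplex" and b: "b \<in> prob_simplex"
    and A: "\<And>j. a $ j \<noteq> 0 \<Longrightarrow> j \<in> A" "\<And>j. b $ j \<noteq> 0 \<Longrightarrow> j \<in> A"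
    and XY: "\<And>j. j \<in> A \<Longrightarrow> X $ j = Y $ j"
    and ortho: "\<And>j. j \<in> A \<Longrightarrow> inner (point_comb X a) (X $ j) = (norm (point_comb X a))\<^sup>2"
      "\<And>j. j \<in> A \<Longrightarrow> inner (point_comb Y b) (Y $ j) = (norm (point_comb Y b))\<^sup>2"
  shows "point_comb X a = point_comb Y b"
proof -
  define p q where "p = point_comb X a" and "q = point_comb Y b"
  have "inner p q = (norm p)\<^sup>2"
    unfolding q_def by (rule inner_point_comb_const[OF b]) (use A XY ortho in \<open>auto simp: p_def\<close>)
  moreover have "inner q p = (norm q)\<^sup>2"
    unfolding p_def by (rule inner_point_comb_const[OF a]) (use A XY ortho in \<open>auto simp: q_def\<close>)
  ultimately have "inner (p - q) (p - q) = 0"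
    by (simp add: inner_diff_left inner_diff_right inner_commute power2_norm_eq_inner)
  then show ?thesis by (simp add: p_def q_def)
qed

text \<open>Moving \<open>x_i\<close> along coordinate \<open>k\<close> leaves the points in
  \<open>A\<close> fixed, so by uniqueness the combination \<open>p\<close> is unchanged.
  Orthogonality at \<open>x_i\<close> then forces \<open>s * p $ k = 0\<close>. The threshold
  \<open>\<epsilon>\<close> and the fixed \<open>A\<close> replace open conditions by closed
  ones.\<close>

lemma null_degenerate_piece:
  fixes A :: "'n::finite set" and k :: "'d::finite"
  assumes "\<epsilon> > 0" and "i \<notin> A"
  shows "{X :: (real^'d)^'n. \<exists>a\<in>prob_simplex. \<epsilon> \<le> \<bar>point_comb X a $ k\<bar> \<and>
     (\<forall>j. j \<notin> A \<longrightarrow> a $ j = 0) \<and>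
     (\<forall>j\<in>insert i A. inner (point_comb X a) (X $ j) = (norm (point_comb X a))\<^sup>2)} \<in> null_sets lborel"
    (is "?C \<in> _")
proof (rule null_sets_if_line_meets_once[where b = "axis i (axis k 1)"])
  let ?T = "{(a :: real^'n, X :: (real^'d)^'n). \<epsilon> \<le> \<bar>point_comb X a $ k\<bar> \<and>
     (\<forall>j. j \<notin> A \<longrightarrow> a $ j = 0) \<and>
     (\<forall>j\<in>insert i A. inner (point_comb X a) (X $ j) = (norm (point_comb X a))\<^sup>2)}"
  have "?T = {z. \<epsilon> \<le> \<bar>point_comb (snd z) (fst z) $ k\<bar>} \<inter> (\<Inter>j\<in>-A. {z. fst z $ j = 0}) \<inter>
     (\<Inter>j\<in>insert i A. {z. inner (point_comb (snd z) (fst z)) (snd z $ j) =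
        (norm (point_comb (snd z) (fst z)))\<^sup>2})"
    by auto
  then have "closed ?T"
    by (simp only: point_comb_def)
       (intro closed_INT closed_Int ballI closed_Collect_le closed_Collect_eq continuous_intros)
  \<comment> \<open>The existential over coefficients is a projection along a compact set, which
    preserves closedness.\<close>
  from closed_compact_projection[OF compact_prob_simplex this] have "closed ?C"
    by (simp add: Bex_def)
  then show "?C \<in> sets borel" by (rule borel_closed)
  fix X :: "(real^'d)^'n" and s
  let ?Y = "X + s *\<^sub>R axis i (axis k 1)"
  assume "X \<in> ?C" "?Y \<in> ?C"
  then obtain a b where a: "a \<in> prob_simplex" "\<epsilon> \<le> \<bar>point_comb X a $ k\<bar>" "\<And>j. j \<notin> A \<Longrightarrow> a $ j = 0"
      "\<And>j. j \<in> insert i A \<Longrightarrow> inner (point_comb X a) (X $ j) = (norm (point_comb X a))\<^sup>2"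
    and b: "b \<in> prob_simplex" "\<And>j. j \<notin> A \<Longrightarrow> b $ j = 0"
      "\<And>j. j \<in> insert i A \<Longrightarrow> inner (point_comb ?Y b) (?Y $ j) = (norm (point_comb ?Y b))\<^sup>2"
    by blast
  have eq: "point_comb X a = point_comb ?Y b"
  proof (rule point_comb_unique[where A = A])
    show "X $ j = ?Y $ j" if "j \<in> A" for j
      using that assms(2) by (auto simp: axis_def)
  qed (use a b in auto)
  have "inner (point_comb X a) (?Y $ i) = inner (point_comb X a) (X $ i)"
    using a(4)[of i] b(3)[of i] by (simp add: eq)
  then have "s * point_comb X a $ k = 0"
    by (simp add: inner_add_right inner_axis)
  then show "s = 0" using a(2) assms(1) by auto
qed

text \<open>Countable union of the pieces over \<open>A\<close>, \<open>i\<close>, \<open>k\<close>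
  and the thresholds \<open>1 / (n + 1)\<close>; a degenerate dataset falls into the piece whose
  \<open>A\<close> is the set of contributing points.\<close>

lemma AE_not_degenerate: "AE X in (lborel :: ((real^'d)^'n) measure). \<not> degenerate X"
proof -
  define C where "C A i k n = {X :: (real^'d)^'n. \<exists>a\<in>prob_simplex.
     1 / real (Suc n) \<le> \<bar>point_comb X a $ k\<bar> \<and> (\<forall>j. j \<notin> A \<longrightarrow> a $ j = 0) \<and>
     (\<forall>j\<in>insert i A. inner (point_comb X a) (X $ j) = (norm (point_comb X a))\<^sup>2)}"
    for A :: "'n set" and i k n
  have "(\<Union>A. \<Union>i\<in>-A. \<Union>k. \<Union>n. C A i k n) \<in> null_sets lborel"
    unfolding C_def by (intro null_sets_UN' null_degenerate_piece) auto
  moreover have "{X \<in> space lborel. \<not> \<not> degenerate X} \<subseteq> (\<Union>A. \<Union>i\<in>-A. \<Union>k. \<Union>n. C A i k n)"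
  proof
    fix X :: "(real^'d)^'n" assume "X \<in> {X \<in> space lborel. \<not> \<not> degenerate X}"
    then have "degenerate X" by simp
    then obtain a i where a: "a \<in> prob_simplex" "point_comb X a \<noteq> 0" "a $ i = 0"
      "\<And>j. j = i \<or> a $ j \<noteq> 0 \<Longrightarrow> inner (point_comb X a) (X $ j) = (norm (point_comb X a))\<^sup>2"
      unfolding degenerate_def by blast
    obtain k where k: "point_comb X a $ k \<noteq> 0"
      using a(2) by (auto simp: vec_eq_iff)
    obtain n where n: "1 / real (Suc n) < \<bar>point_comb X a $ k\<bar>"
      using nat_approx_posE[of "\<bar>point_comb X a $ k\<bar>"] k by auto
    have "X \<in> C {j. a $ j \<noteq> 0} i k n"
      unfolding C_def using a n by (intro CollectI bexI[of _ a]) auto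
    then show "X \<in> (\<Union>A. \<Union>i\<in>-A. \<Union>k. \<Union>n. C A i k n)"
      unfolding UN_iff using a(3)
      by (intro bexI[of _ "{j. a $ j \<noteq> 0}"] bexI[of _ i] bexI[of _ k] bexI[of _ n]) auto
  qed
  ultimately show ?thesis by (rule AE_I')
qed

section \<open>The max-margin vector from the point of the convex hull nearest to the origin\<close>

text \<open>Supplies dual multipliers for the margin problem. Compactness gives a nearest point
  \<open>p\<close>, and a separating vector has positive inner product with it, so it is
  nonzero.\<close>

lemma separable_min_norm_point:
  fixes X :: "(real^'d)^'n"
  assumes "separable X"
  obtains a where "a \<in> prob_simplex" "point_comb X a \<noteq> 0"
    "\<And>i. (norm (point_comb X a))\<^sup>2 \<le> inner (point_comb X a) (X $ i)"
    "\<And>i. a $ i \<noteq> 0 \<Longrightarrow> inner (point_comb X a) (X $ i) = (norm (point_comb X a))\<^sup>2"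
proof -
  have ax: "axis i 1 \<in> (prob_simplex :: (real^'n) set)" for i
    by (auto simp: prob_simplex_def axis_def)
  have comb_ax: "point_comb X (axis i 1) = X $ i" for i
    by (simp add: point_comb_def axis_def if_distrib[of "\<lambda>c. c *\<^sub>R _"] cong: if_cong)
  have lin: "linear (point_comb X)"
    by (rule linearI) (simp_all add: point_comb_def scaleR_add_left sum.distrib scaleR_sum_right)
  have "(prob_simplex :: (real^'n) set) \<noteq> {}" using ax by (metis empty_iff)
  moreover have "continuous_on prob_simplex (\<lambda>a. norm (point_comb X a))"
    unfolding point_comb_def by (intro continuous_intros)
  ultimately have "\<exists>a\<in>prob_simplex. \<forall>b\<in>prob_simplex.
      norm (point_comb X a) \<le> norm (point_comb X b)"
    by (rule continuous_attains_inf[OF compact_prob_simplex])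
  then obtain a where a: "a \<in> prob_simplex"
      "\<And>b. b \<in> prob_simplex \<Longrightarrow> norm (point_comb X a) \<le> norm (point_comb X b)"
    by blast
  define p where "p = point_comb X a"
  let ?S = "point_comb X ` prob_simplex"
  have "convex (prob_simplex :: (real^'n) set)"
    unfolding convex_def prob_simplex_def
    by (simp add: sum.distrib flip: sum_distrib_left)
  then have "convex ?S" by (rule convex_linear_image[OF lin])
  moreover have "closed ?S"
    unfolding point_comb_def
    by (intro compact_imp_closed compact_continuous_image continuous_intros compact_prob_simplex)
  \<comment> \<open>First-order optimality of \<open>p\<close> as the projection of the origin onto
    the hull.\<close>
  ultimately have ge: "(norm p)\<^sup>2 \<le> inner p (X $ i)" for i
    using any_closest_point_dot[of ?S p "X $ i" 0] a ax[of i] comb_ax[of i]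
    by (force simp: p_def inner_diff_right power2_norm_eq_inner)
  have "inner p p = (\<Sum>i\<in>UNIV. a $ i * inner p (X $ i))"
    by (subst (2) p_def) (rule inner_point_comb)
  moreover have "inner p p = (\<Sum>i\<in>UNIV. a $ i * (norm p)\<^sup>2)"
    using a(1) by (simp add: prob_simplex_def sum_distrib_right[symmetric] power2_norm_eq_inner)
  \<comment> \<open>Complementary slackness: nonnegative terms with sum 0 all vanish.\<close>
  ultimately have "(\<Sum>i\<in>UNIV. a $ i * (inner p (X $ i) - (norm p)\<^sup>2)) = 0"
    by (simp add: right_diff_distrib sum_subtractf)
  then have eq: "inner p (X $ i) = (norm p)\<^sup>2" if "a $ i \<noteq> 0" for i
    using that ge a(1) by (subst (asm) sum_nonneg_eq_0_iff) (auto simp: prob_simplex_def)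
  obtain w where w: "\<And>i. inner w (X $ i) > 0"
    using assms unfolding separable_def by blast
  have "inner w p > 0"
  proof -
    obtain i where "a $ i \<noteq> 0"
      using a(1) by (force simp: prob_simplex_def)
    then show ?thesis
      unfolding p_def inner_point_comb using w a(1)
      by (intro sum_pos2[of _ i]) (auto simp: prob_simplex_def less_le)
  qed
  then have "p \<noteq> 0" by auto
  with a(1) ge eq that show thesis unfolding p_def by blast
qed

text \<open>Averaging the constraints on \<open>v\<close> with weights \<open>a\<close> gives
  \<open>1 \<le> inner v p\<close>. Hence \<open>h = p / (norm p)^2\<close> satisfies the inequality
  \<open>key\<close>, which yields minimality and also the uniqueness required by
  \<open>THE\<close>.\<close>

lemma max_margin_eq:
  fixes X :: "(real^'d)^'n"
  assumes a: "a \<in> prob_simplex" and p0: "point_comb X a \<noteq> 0"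
    and ge: "\<And>i. (norm (point_comb X a))\<^sup>2 \<le> inner (point_comb X a) (X $ i)"
  shows "max_margin X = (1 / (norm (point_comb X a))\<^sup>2) *\<^sub>R point_comb X a"
proof -
  define p where "p = point_comb X a"
  define h where "h = (1 / (norm p)\<^sup>2) *\<^sub>R p"
  have p: "p \<noteq> 0" using p0 by (simp add: p_def)
  have feas: "1 \<le> inner h (X $ i)" for i
    using ge[of i] p by (simp add: h_def p_def field_simps)
  have hh: "inner h h = 1 / (norm p)\<^sup>2"
    using p by (simp add: h_def power2_norm_eq_inner)
  have vh: "inner h h \<le> inner v h" if v: "\<And>i. 1 \<le> inner v (X $ i)" for v
  proof -
    have "1 = (\<Sum>i\<in>UNIV. a $ i * 1)" using a by (simp add: prob_simplex_def)
    also have "\<dots> \<le> (\<Sum>i\<in>UNIV. a $ i * inner v (X $ i))"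
      using a v by (intro sum_mono mult_left_mono) (auto simp: prob_simplex_def)
    also have "\<dots> = inner v p" by (simp add: p_def inner_point_comb)
    finally show ?thesis unfolding hh using p by (simp add: h_def divide_right_mono)
  qed
  have key: "(norm h)\<^sup>2 + (norm (v - h))\<^sup>2 \<le> (norm v)\<^sup>2" if v: "\<And>i. 1 \<le> inner v (X $ i)" for v
    using vh[OF v]
    by (simp add: power2_norm_eq_inner inner_diff_left inner_diff_right inner_commute)
  have min: "(norm h)\<^sup>2 \<le> (norm v)\<^sup>2" if "\<And>i. 1 \<le> inner v (X $ i)" for v
    using key[OF that] zero_le_power2[of "norm (v - h)"] by linarith
  have "max_margin X = h"
    unfolding max_margin_def
  proof (rule the_equality)
    show "(\<forall>i. 1 \<le> inner h (X $ i)) \<and>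
        (\<forall>v. (\<forall>i. 1 \<le> inner v (X $ i)) \<longrightarrow> (norm h)\<^sup>2 \<le> (norm v)\<^sup>2)"
      using feas min by blast
    fix v assume v: "(\<forall>i. 1 \<le> inner v (X $ i)) \<and>
        (\<forall>u. (\<forall>i. 1 \<le> inner u (X $ i)) \<longrightarrow> (norm v)\<^sup>2 \<le> (norm u)\<^sup>2)"
    then have "(norm v)\<^sup>2 \<le> (norm h)\<^sup>2" using feas by blast
    moreover have "(norm h)\<^sup>2 + (norm (v - h))\<^sup>2 \<le> (norm v)\<^sup>2" using key v by blast
    ultimately have "(norm (v - h))\<^sup>2 \<le> 0" by linarith
    then show "v = h" by simp
  qed
  then show ?thesis by (simp add: h_def p_def)
qed

text \<open>Strict complementarity: a point on the supporting face with coefficient 0 would witness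
  degeneracy.\<close>

lemma not_degenerate_support:
  fixes X :: "(real^'d)^'n"
  assumes nd: "\<not> degenerate X" and a: "a \<in> prob_simplex" and p0: "point_comb X a \<noteq> 0"
    and eq: "\<And>i. a $ i \<noteq> 0 \<Longrightarrow> inner (point_comb X a) (X $ i) = (norm (point_comb X a))\<^sup>2"
  shows "a $ i > 0 \<longleftrightarrow> inner (point_comb X a) (X $ i) = (norm (point_comb X a))\<^sup>2"
proof
  assume *: "inner (point_comb X a) (X $ i) = (norm (point_comb X a))\<^sup>2"
  have "a $ i \<noteq> 0"
    using nd a p0 eq * unfolding degenerate_def by blast
  then show "a $ i > 0" using a by (simp add: prob_simplex_def less_le)
qed (use eq in auto)

text \<open>Moving the coefficients of the combination along an affine dependence of the contributing
  points until the first one vanishes exhibits a degeneracy.\<close>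

lemma not_degenerate_independent:
  fixes X :: "(real^'d)^'n"
  assumes nd: "\<not> degenerate X" and a: "a \<in> prob_simplex" and p0: "point_comb X a \<noteq> 0"
    and eq: "\<And>i. a $ i \<noteq> 0 \<Longrightarrow> inner (point_comb X a) (X $ i) = (norm (point_comb X a))\<^sup>2"
    and c0: "point_comb X c = 0" and supp: "\<And>i. a $ i = 0 \<Longrightarrow> c $ i = 0"
  shows "c = 0"
proof (rule ccontr)
  assume "c \<noteq> 0"
  define p where "p = point_comb X a"
  \<comment> \<open>Pairing with \<open>p\<close>, which is constant on the contributing points,
    shows that \<open>c\<close> has total weight 0. So \<open>c\<close> has a negative entry, and
    moving along it preserves total weight 1.\<close>
  have "0 = inner p (point_comb X c)" by (simp add: c0)
  also have "\<dots> = (\<Sum>i\<in>UNIV. c $ i * (norm p)\<^sup>2)"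
    unfolding inner_point_comb using eq supp by (intro sum.cong) (auto simp: p_def)
  finally have sum0: "(\<Sum>i\<in>UNIV. c $ i) = 0"
    using p0 by (simp add: sum_distrib_right[symmetric] p_def)
  define J where "J = {j. c $ j < 0}"
  have "J \<noteq> {}"
  proof
    assume "J = {}"
    then have "\<And>i. 0 \<le> c $ i" by (auto simp: J_def not_less)
    with sum0 have "c = 0" by (simp add: sum_nonneg_eq_0_iff vec_eq_iff)
    with \<open>c \<noteq> 0\<close> show False by simp
  qed
  then obtain i where i: "i \<in> J" "\<And>j. j \<in> J \<Longrightarrow> a $ i / (- c $ i) \<le> a $ j / (- c $ j)"
    using ex_is_arg_min_if_finite[of J "\<lambda>j. a $ j / (- c $ j)"]
    by (auto simp: is_arg_min_linorder)
  define s where "s = a $ i / (- c $ i)"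
  define b where "b = a + s *\<^sub>R c"
  have s: "0 \<le> s" using i(1) a by (auto simp: s_def J_def prob_simplex_def divide_nonneg_neg)
  have "0 \<le> b $ j" for j
  proof (cases "j \<in> J")
    case True
    then have "s * (- c $ j) \<le> a $ j"
      using i(2)[OF True] pos_le_divide_eq[of "- c $ j" s "a $ j"]
      unfolding s_def[symmetric] by (simp add: J_def)
    then show ?thesis by (simp add: b_def)
  next
    case False
    then show ?thesis using s a by (simp add: b_def J_def prob_simplex_def)
  qed
  then have b: "b \<in> prob_simplex"
    using a sum0 by (simp add: prob_simplex_def b_def sum.distrib sum_distrib_left[symmetric])
  have pb: "point_comb X b = point_comb X a"
    using c0 by (simp add: point_comb_def b_def scaleR_add_left sum.distrib
        scaleR_sum_right[symmetric] flip: scaleR_scaleR)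
  have "b $ i = 0" using i(1) by (simp add: b_def s_def J_def)
  moreover have "a $ i \<noteq> 0" using i(1) supp by (force simp: J_def)
  moreover have "a $ j \<noteq> 0" if "b $ j \<noteq> 0" for j using that supp by (auto simp: b_def)
  ultimately have "degenerate X"
    unfolding degenerate_def using b pb p0 eq by (intro bexI[of _ b] exI[of _ i]) auto
  with nd show False ..
qed

text \<open>Independence of the contributing points makes the map \<open>T\<close> to their margins
  onto: a residual \<open>z\<close> orthogonal to its range is the coefficient vector of a vanishing
  combination, hence 0.\<close>

lemma not_degenerate_solve:
  fixes X :: "(real^'d)^'n"
  assumes nd: "\<not> degenerate X" and a: "a \<in> prob_simplex" and p0: "point_comb X a \<noteq> 0"
    and eq: "\<And>i. a $ i \<noteq> 0 \<Longrightarrow> inner (point_comb X a) (X $ i) = (norm (point_comb X a))\<^sup>2"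
  shows "\<exists>w. \<forall>i. a $ i \<noteq> 0 \<longrightarrow> inner w (X $ i) = c i"
proof -
  define T where "T w = (\<chi> i. if a $ i \<noteq> 0 then inner w (X $ i) else 0)" for w
  define t where "t = (\<chi> i. if a $ i \<noteq> 0 then c i else 0)"
  have "linear T"
    by (rule linearI) (auto simp: T_def vec_eq_iff inner_add_left)
  then have span: "span (range T) = range T"
    using linear_subspace_image[of T UNIV] by (simp add: span_eq_iff subspace_UNIV)
  obtain y z where yz: "y \<in> span (range T)" "\<And>w. w \<in> span (range T) \<Longrightarrow> orthogonal z w" "t = y + z"
    by (rule orthogonal_subspace_decomp_exists[of "range T" t]) auto
  obtain w where w: "y = T w" using yz(1) span by auto
  have zsupp: "z $ i = 0" if "a $ i = 0" for i
  proof -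
    have "t $ i = y $ i + z $ i" using yz(3) by simp
    then show ?thesis using that by (simp add: t_def w T_def)
  qed
  have "inner u (point_comb X z) = 0" for u
  proof -
    have "inner z (T u) = 0"
      using yz(2)[of "T u"] span by (simp add: orthogonal_def)
    moreover have "inner u (point_comb X z) = inner z (T u)"
      unfolding inner_point_comb inner_vec_def[of z] by (rule sum.cong) (auto simp: T_def zsupp)
    ultimately show ?thesis by simp
  qed
  then have "point_comb X z = 0" using inner_eq_zero_iff by blast
  from not_degenerate_independent[OF nd a p0 eq this zsupp] have "z = 0" by simp
  with yz(3) w have "T w = t" by simp
  then have "inner w (X $ i) = c i" if "a $ i \<noteq> 0" for i
  proof -
    from \<open>T w = t\<close> have "T w $ i = t $ i" by simp
    with that show ?thesis by (simp add: T_def t_def)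
  qed
  then show ?thesis by blast
qed

section \<open>Boundedness of the residual\<close>

text \<open>Here \<open>q\<close> stands for minus the slope at margin \<open>u\<close>, and
  \<open>\<rho>\<close> for the residual margin. A pure exponential with
  \<open>\<epsilon> = 0\<close> would give \<open>(exp (- \<rho>) - 1) * \<rho> / t\<close>, which
  is at most 0. The bound collects the cost of the momentum error \<open>\<epsilon>\<close> and of
  the two tail corrections; the sign of \<open>\<rho>\<close> decides which tail bound
  applies.\<close>

lemma support_term_bound:
  fixes t \<rho> c \<epsilon> \<mu>p \<mu>m q u :: real
  assumes t: "0 < t" and \<mu>: "0 < \<mu>p" "0 < \<mu>m"
    and u: "u = \<rho> + ln t + c - \<epsilon>" and \<epsilon>: "\<bar>\<epsilon>\<bar> \<le> 1/4" and small: "exp (- \<mu>m * u) \<le> 1/4"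
    and up: "q \<le> (1 + exp (- \<mu>p * u)) * exp (- u)"
    and lo: "(1 - exp (- \<mu>m * u)) * exp (- u) \<le> q"
  shows "(exp c * q - 1 / t) * \<rho> \<le> 2 * (\<bar>\<epsilon>\<bar> / t) + 2 * exp (\<mu>p * (\<bar>c\<bar> + 1)) * t powr (- 1 - \<mu>p)
    + exp (\<mu>m * (\<bar>c\<bar> + 2)) * t powr (- 1 - \<mu>m)"
proof -
  define Kp where "Kp = exp (\<mu>p * (\<bar>c\<bar> + 1)) * t powr (- \<mu>p)"
  define Km where "Km = exp (\<mu>m * (\<bar>c\<bar> + 2)) * t powr (- \<mu>m)"
  have K: "0 \<le> Kp" "0 \<le> Km" by (auto simp: Kp_def Km_def)
  have eu: "exp c * exp (- u) = exp \<epsilon> * exp (- \<rho>) / t"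
    using t by (simp add: u exp_diff exp_add exp_minus field_simps)
  \<comment> \<open>Once \<open>u\<close> is at least \<open>ln t\<close> up to a constant, a
    relative tail error becomes a power of \<open>t\<close>.\<close>
  have eK: "exp (- \<mu> * u) \<le> exp (\<mu> * d) * t powr (- \<mu>)" if "0 < \<mu>" "- d \<le> u - ln t" for \<mu> d
  proof -
    have "\<mu> * (- d) \<le> \<mu> * (u - ln t)" using that by (intro mult_left_mono) auto
    then have "exp (- \<mu> * u) \<le> exp (\<mu> * d + - \<mu> * ln t)" by (simp add: algebra_simps)
    also have "\<dots> = exp (\<mu> * d) * t powr (- \<mu>)" using t by (simp add: powr_def flip: exp_add)
    finally show ?thesis .
  qed
  have goal: "2 * \<bar>\<epsilon>\<bar> / t + 2 * exp (\<mu>p * (\<bar>c\<bar> + 1)) * t powr (- 1 - \<mu>p)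
      + exp (\<mu>m * (\<bar>c\<bar> + 2)) * t powr (- 1 - \<mu>m) = (2 * \<bar>\<epsilon>\<bar> + 2 * Kp + Km) / t"
    using t by (simp add: Kp_def Km_def powr_diff powr_minus divide_simps)
  have "(exp c * q - 1 / t) * \<rho> \<le> (2 * \<bar>\<epsilon>\<bar> + 2 * Kp + Km) / t"
  proof (cases "0 \<le> \<rho>")
    case True
    \<comment> \<open>Every error factor multiplies \<open>y\<close>, which is bounded uniformly in
      \<open>\<rho>\<close>.\<close>
    define y where "y = exp (- \<rho>) * \<rho>"
    have y: "0 \<le> y" "y \<le> \<rho>" "y \<le> 1"
    proof -
      show "0 \<le> y" using True by (simp add: y_def)
      show "y \<le> \<rho>" using True by (simp add: y_def mult_left_le_one_le)
      have "\<rho> \<le> exp \<rho>" using exp_ge_add_one_self[of \<rho>] by linarith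
      then show "y \<le> 1" by (simp add: y_def exp_minus field_simps)
    qed
    have e\<epsilon>: "exp \<epsilon> \<le> 1 + 2 * \<bar>\<epsilon>\<bar>" using exp_bound_lemma[of \<epsilon>] \<epsilon> by simp
    have "exp (- \<mu>p * u) \<le> Kp"
      unfolding Kp_def using True \<epsilon> \<mu> by (intro eK) (auto simp: u)
    then have "q \<le> (1 + Kp) * exp (- u)"
      using up by (meson add_left_mono exp_ge_zero mult_right_mono order_trans)
    then have "exp c * q \<le> exp c * ((1 + Kp) * exp (- u))"
      by (intro mult_left_mono) auto
    also have "\<dots> = (1 + Kp) * (exp c * exp (- u))" by simp
    also have "\<dots> = (1 + Kp) * exp \<epsilon> * exp (- \<rho>) / t" unfolding eu by simp
    finally have "(exp c * q - 1 / t) * \<rho> \<le> ((1 + Kp) * exp \<epsilon> * exp (- \<rho>) / t - 1 / t) * \<rho>"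
      using True by (intro mult_right_mono) auto
    also have "\<dots> = ((1 + Kp) * exp \<epsilon> * y - \<rho>) / t"
      using t by (simp add: y_def divide_simps) (simp add: algebra_simps)
    also have "\<dots> \<le> (2 * \<bar>\<epsilon>\<bar> + 2 * Kp + Km) / t"
    proof (intro divide_right_mono)
      have "exp \<epsilon> * y \<le> (1 + 2 * \<bar>\<epsilon>\<bar>) * y" using e\<epsilon> y by (intro mult_right_mono)
      moreover have "\<bar>\<epsilon>\<bar> * y \<le> \<bar>\<epsilon>\<bar>" using y by (simp add: mult_left_le)
      moreover have "Kp * (exp \<epsilon> * y) \<le> Kp * (2 * 1)"
        using e\<epsilon> \<epsilon> y K by (intro mult_left_mono mult_mono) auto
      ultimately show "(1 + Kp) * exp \<epsilon> * y - \<rho> \<le> 2 * \<bar>\<epsilon>\<bar> + 2 * Kp + Km"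
        using y K by (simp add: algebra_simps)
    qed (use t in simp)
    finally show ?thesis .
  next
    case False
    define k where "k = exp (- \<mu>m * u)"
    define z where "z = (1 - k) * exp \<epsilon> * exp (- \<rho>)"
    have k: "0 \<le> k" "k \<le> 1/4" using small by (auto simp: k_def)
    have "exp c * ((1 - k) * exp (- u)) \<le> exp c * q"
      using lo by (intro mult_left_mono) (auto simp: k_def)
    moreover have "exp c * ((1 - k) * exp (- u)) = (1 - k) * (exp c * exp (- u))" by simp
    ultimately have "z / t \<le> exp c * q" unfolding eu by (simp add: z_def)
    then have "(exp c * q - 1 / t) * \<rho> \<le> (z / t - 1 / t) * \<rho>"
      using False by (intro mult_right_mono_neg) auto
    also have "\<dots> = (1 - z) * (- \<rho>) / t"
      by (simp add: diff_divide_distrib left_diff_distrib)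
    also have "\<dots> \<le> (2 * \<bar>\<epsilon>\<bar> + 2 * Kp + Km) / t"
    proof (intro divide_right_mono)
      have e\<epsilon>: "1 + \<epsilon> \<le> exp \<epsilon>" by simp
      show "(1 - z) * (- \<rho>) \<le> 2 * \<bar>\<epsilon>\<bar> + 2 * Kp + Km"
      proof (cases "1 \<le> z")
        case True
        then have "(1 - z) * (- \<rho>) \<le> 0" using False by (intro mult_nonpos_nonneg) auto
        then show ?thesis using K by linarith
      next
        case False
        \<comment> \<open>A very negative \<open>\<rho>\<close> makes \<open>z\<close> large, which
          was the harmless case. Here \<open>z < 1\<close> gives
          \<open>exp (- \<rho>) < 16/9\<close>, so \<open>- \<rho> \<le> 1\<close>, and then
          \<open>u\<close> is close enough to \<open>ln t\<close> for \<open>eK\<close>.\<close>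
        have ke: "3/4 * (3/4) \<le> (1 - k) * exp \<epsilon>"
        proof (rule mult_mono)
          show "3/4 \<le> exp \<epsilon>" using e\<epsilon> \<epsilon> by linarith
        qed (use k in auto)
        have "3/4 * (3/4) * exp (- \<rho>) \<le> z"
          unfolding z_def using ke by (intro mult_right_mono) auto
        then have "exp (- \<rho>) < 2" using False by simp
        then have \<rho>1: "- \<rho> \<le> 1" using exp_ge_add_one_self[of "- \<rho>"] by linarith
        then have kK: "k \<le> Km"
          unfolding Km_def k_def using \<epsilon> \<mu> by (intro eK) (auto simp: u)
        have z1: "(1 - k) * (1 + \<epsilon>) * 1 \<le> z"
          unfolding z_def using k e\<epsilon> \<epsilon> \<open>\<not> 0 \<le> \<rho>\<close> by (intro mult_mono) auto
        have k\<epsilon>: "\<bar>k * \<epsilon>\<bar> \<le> \<bar>\<epsilon>\<bar>"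
          using k by (simp add: abs_mult mult_left_le_one_le)
        have "(1 - z) * (- \<rho>) \<le> (1 - z) * 1"
          using False \<rho>1 by (intro mult_left_mono) auto
        also have "\<dots> \<le> 2 * \<bar>\<epsilon>\<bar> + Km"
          using kK z1 k\<epsilon> by (simp add: algebra_simps)
        also have "\<dots> \<le> 2 * \<bar>\<epsilon>\<bar> + 2 * Kp + Km" using K by simp
        finally show ?thesis .
      qed
    qed (use t in simp)
    finally show ?thesis .
  qed
  then show ?thesis using goal by simp
qed

text \<open>For \<open>\<rho> \<ge> 0\<close> the product \<open>exp (- \<rho>) * \<rho>\<close> is
  at most 1 and the factor \<open>t powr (- \<theta>)\<close> remains, summable for margins
  \<open>\<theta> > 1\<close>. For negative \<open>\<rho>\<close> the term has the right sign
  already.\<close>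

lemma nonsupport_term_bound:
  fixes t \<rho> c \<epsilon> \<mu>p q u \<theta> :: real
  assumes t: "0 < t" and \<mu>: "0 < \<mu>p"
    and u: "u = \<rho> + \<theta> * ln t + c - \<epsilon>" "0 \<le> u" and \<epsilon>: "\<bar>\<epsilon>\<bar> \<le> 1/4"
    and up: "q \<le> (1 + exp (- \<mu>p * u)) * exp (- u)" and q: "0 \<le> q"
  shows "q * \<rho> \<le> 2 * exp (\<bar>c\<bar> + 1) * t powr (- \<theta>)"
proof (cases "0 \<le> \<rho>")
  case True
  have "q \<le> 2 * exp (- u)"
  proof -
    have "(1 + exp (- \<mu>p * u)) * exp (- u) \<le> 2 * exp (- u)"
      using \<mu> u(2) by (intro mult_right_mono) auto
    then show ?thesis using up by linarith
  qed
  then have "q * \<rho> \<le> 2 * exp (- u) * \<rho>" using True by (rule mult_right_mono)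
  also have "\<dots> = 2 * exp (\<epsilon> - c) * t powr (- \<theta>) * (exp (- \<rho>) * \<rho>)"
    using t by (simp add: u(1) powr_def exp_diff exp_add exp_minus field_simps)
  also have "\<dots> \<le> 2 * exp (\<bar>c\<bar> + 1) * t powr (- \<theta>) * 1"
  proof (intro mult_mono)
    have "\<rho> \<le> exp \<rho>" using exp_ge_add_one_self[of \<rho>] by linarith
    then show "exp (- \<rho>) * \<rho> \<le> 1" by (simp add: exp_minus field_simps)
  qed (use \<epsilon> True in auto)
  finally show ?thesis by simp
next
  case False
  then have "q * \<rho> \<le> 0" using q by (simp add: mult_nonneg_nonpos)
  also have "0 \<le> 2 * exp (\<bar>c\<bar> + 1) * t powr (- \<theta>)" by simp
  finally show ?thesis .
qed

section \<open>A discrete Gronwall bound and summable errors\<close>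

text \<open>From \<open>n0\<close> on, \<open>1 + d n \<le> exp (d n)\<close> turns the product of
  growth factors into the exponential of a convergent sum; the finitely many earlier values enter
  through a maximum.\<close>

lemma bounded_if_summable_growth:
  fixes y d :: "nat \<Rightarrow> real"
  assumes "summable d" and y: "\<And>n. 0 \<le> y n"
    and step: "eventually (\<lambda>n. 0 \<le> d n \<and> y (Suc n) \<le> (1 + d n) * y n) sequentially"
  shows "\<exists>C. \<forall>n. y n \<le> C"
proof -
  obtain n0 where n0: "\<And>n. n0 \<le> n \<Longrightarrow> 0 \<le> d n \<and> y (Suc n) \<le> (1 + d n) * y n"
    using step by (auto simp: eventually_sequentially)
  have sm: "summable (\<lambda>k. d (k + n0))" using assms(1) by (rule summable_ignore_initial_segment)
  have "y (n + n0) \<le> y n0 * exp (\<Sum>k<n. d (k + n0))" for n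
  proof (induction n)
    case (Suc n)
    have "y (Suc n + n0) \<le> (1 + d (n + n0)) * y (n + n0)" using n0[of "n + n0"] by simp
    also have "\<dots> \<le> exp (d (n + n0)) * (y n0 * exp (\<Sum>k<n. d (k + n0)))"
      using Suc y by (intro mult_mono) (auto simp: exp_ge_add_one_self)
    finally show ?case by (simp add: exp_add mult_ac)
  qed simp
  also have "y n0 * exp (\<Sum>k<n. d (k + n0)) \<le> y n0 * exp (\<Sum>k. d (k + n0))" for n
    using n0 y by (intro mult_left_mono) (auto intro!: sum_le_suminf[OF sm])
  finally have tail: "y (n + n0) \<le> y n0 * exp (\<Sum>k. d (k + n0))" for n .
  have "y n \<le> max (Max (y ` {..n0})) (y n0 * exp (\<Sum>k. d (k + n0)))" for n
  proof (cases "n \<le> n0")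
    case True
    then have "y n \<le> Max (y ` {..n0})" by (intro Max_ge) auto
    then show ?thesis by simp
  next
    case False
    then show ?thesis using tail[of "n - n0"] by simp
  qed
  then show ?thesis by blast
qed

lemma summable_Suc_powr: "s < - 1 \<Longrightarrow> summable (\<lambda>n. real (Suc n) powr s)"
  by (rule iffD2[OF summable_Suc_iff[of "\<lambda>n. real n powr s"]]) (simp add: summable_real_powr_iff)

lemma summable_inverse_Suc_power2: "summable (\<lambda>n. (1 / real (Suc n))\<^sup>2)"
  using summable_Suc_powr[of "-2"] by (simp add: powr_minus powr_numeral power_divide inverse_eq_divide)

text \<open>With \<open>t = n + 1\<close>, replacing the increment of \<open>ln t\<close> by
  \<open>1 / t\<close> costs at most \<open>1 / t^2\<close>, which is summable.\<close>

lemma ln_Suc_diff_bounds: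
  "0 \<le> ln (real (Suc (Suc n))) - ln (real (Suc n))"
  "ln (real (Suc (Suc n))) - ln (real (Suc n)) \<le> 1 / real (Suc n)"
  "1 / real (Suc n) - (1 / real (Suc n))\<^sup>2 \<le> ln (real (Suc (Suc n))) - ln (real (Suc n))"
proof -
  let ?x = "1 / real (Suc n)"
  have "real (Suc (Suc n)) = real (Suc n) * (1 + ?x)" by (simp add: field_simps)
  moreover have "ln (real (Suc n) * (1 + ?x)) = ln (real (Suc n)) + ln (1 + ?x)"
    by (rule ln_mult_pos) (auto simp: add_pos_nonneg)
  ultimately have eq: "ln (real (Suc (Suc n))) - ln (real (Suc n)) = ln (1 + ?x)"
    by simp
  show "0 \<le> ln (real (Suc (Suc n))) - ln (real (Suc n))" by simp
  show "ln (real (Suc (Suc n))) - ln (real (Suc n)) \<le> ?x"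
    unfolding eq by (rule ln_add_one_self_le_self) simp
  show "?x - ?x\<^sup>2 \<le> ln (real (Suc (Suc n))) - ln (real (Suc n))"
    unfolding eq by (rule ln_one_plus_pos_lower_bound) auto
qed

section \<open>The residual along the iterates\<close>

context gdm_run
begin

text \<open>Extrapolating the iterates by \<open>\<beta> / (1 - \<beta>)\<close> times the last step removes the momentum:
  \<open>Z\<close> performs plain gradient steps, with gradients taken at \<open>W\<close>.\<close>

definition \<kappa> :: real where "\<kappa> = \<beta> * \<eta> / (1 - \<beta>)"

definition Z :: "nat \<Rightarrow> real^'d" where "Z n = W n - \<kappa> *\<^sub>R M n"

lemma Z_Suc: "Z (Suc n) = Z n - \<eta> *\<^sub>R emp_grad loss X (W n)"
proof -
  have "\<eta> *\<^sub>R emp_grad loss X (W n) = (\<eta> / (1 - \<beta>)) *\<^sub>R M (Suc n) - \<kappa> *\<^sub>R M n"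
    by (simp add: grad_eq \<kappa>_def scaleR_diff_right mult_ac)
  moreover have "(\<eta> / (1 - \<beta>)) *\<^sub>R M (Suc n) = \<eta> *\<^sub>R M (Suc n) + \<kappa> *\<^sub>R M (Suc n)"
    using \<beta> by (simp add: \<kappa>_def scaleR_add_left[symmetric] field_simps)
  ultimately show ?thesis
    by (simp add: Z_def W_Suc algebra_simps)
qed

text \<open>Contribution of one data point with multiplier \<open>v\<close>. On the support,
  \<open>\<eta> / N = v * exp c\<close> factors \<open>v\<close> out of the difference; off the
  support only the loss slope remains.\<close>

lemma inner_residual_term_bound:
  assumes sep: "separable X"
    and v: "0 \<le> v" "0 < v \<Longrightarrow> inner h (X $ i) = 1 \<and> \<eta> / real CARD('n) = v * exp (inner wt (X $ i))"
      "v = 0 \<Longrightarrow> 1 < inner h (X $ i)"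
  shows "\<exists>b. summable b \<and> (\<forall>n. 0 \<le> b n) \<and> eventually (\<lambda>n.
    (\<eta> / real CARD('n) * (- deriv loss (inner (W n) (X $ i))) - v / real (Suc n)) *
      inner (Z n - ln (real (Suc n)) *\<^sub>R h - wt) (X $ i) \<le> b n) sequentially"
proof -
  let ?N = "real CARD('n)"
  define u where "u n = inner (W n) (X $ i)" for n
  define \<rho> where "\<rho> n = inner (Z n - ln (real (Suc n)) *\<^sub>R h - wt) (X $ i)" for n
  \<comment> \<open>Margin of \<open>Z\<close> minus margin of \<open>W\<close>: it tends to 0 and
    is square summable because the momenta are.\<close>
  define \<epsilon> where "\<epsilon> n = - \<kappa> * inner (M n) (X $ i)" for n
  define c where "c = inner wt (X $ i)"
  define \<theta> where "\<theta> = inner h (X $ i)"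
  have u: "u n = \<rho> n + \<theta> * ln (real (Suc n)) + c - \<epsilon> n" for n
    by (simp add: u_def \<rho>_def \<epsilon>_def c_def \<theta>_def Z_def inner_diff_left)
  obtain \<mu>p \<mu>m xp xm where \<mu>: "0 < \<mu>p" "0 < \<mu>m"
    and up: "\<And>x. xp < x \<Longrightarrow> - deriv loss x \<le> (1 + exp (- \<mu>p * x)) * exp (- x)"
    and lo: "\<And>x. xm < x \<Longrightarrow> (1 - exp (- \<mu>m * x)) * exp (- x) \<le> - deriv loss x"
    using loss unfolding exp_tail_loss_def by blast
  have neg: "deriv loss x < 0" for x
    using loss unfolding exp_tail_loss_def by blast
  have u_top: "filterlim u at_top sequentially"
    using inner_W_at_top[OF sep, of i] unfolding u_def .
  have "\<epsilon> \<longlonglongrightarrow> - \<kappa> * inner 0 (X $ i)"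
    unfolding \<epsilon>_def by (intro tendsto_intros M_tendsto_0)
  then have "eventually (\<lambda>n. dist (\<epsilon> n) 0 < 1/4) sequentially"
    by (intro tendstoD) auto
  then have ev_\<epsilon>: "eventually (\<lambda>n. \<bar>\<epsilon> n\<bar> \<le> 1/4) sequentially"
    by eventually_elim simp
  have ev_u: "eventually (\<lambda>n. B < u n) sequentially" for B
    using u_top by (auto simp: filterlim_at_top_dense)
  have sum_\<epsilon>: "summable (\<lambda>n. (\<epsilon> n)\<^sup>2)"
  proof (rule summable_comparison_test')
    show "summable (\<lambda>n. (\<kappa>\<^sup>2 * (norm (X $ i))\<^sup>2) * (norm (M n))\<^sup>2)"
      by (intro summable_mult summable_M)
    fix n
    have "(inner (M n) (X $ i))\<^sup>2 \<le> (norm (M n) * norm (X $ i))\<^sup>2"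
      using Cauchy_Schwarz_ineq2[of "M n" "X $ i"] by (metis abs_ge_zero power2_abs power_mono)
    then have "\<kappa>\<^sup>2 * (inner (M n) (X $ i))\<^sup>2 \<le> \<kappa>\<^sup>2 * (norm (M n) * norm (X $ i))\<^sup>2"
      by (rule mult_left_mono) simp
    then show "norm ((\<epsilon> n)\<^sup>2) \<le> (\<kappa>\<^sup>2 * (norm (X $ i))\<^sup>2) * (norm (M n))\<^sup>2"
      by (simp add: \<epsilon>_def power_mult_distrib mult_ac)
  qed
  show ?thesis
  proof (cases "v = 0")
    case True
    define b where "b n = \<eta> / ?N * (2 * exp (\<bar>c\<bar> + 1) * real (Suc n) powr (- \<theta>))" for n
    have "summable b"
      unfolding b_def using v(3)[OF True]
      by (intro summable_mult summable_Suc_powr) (simp add: \<theta>_def)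
    moreover have "eventually (\<lambda>n. (\<eta> / ?N * (- deriv loss (u n)) - v / real (Suc n)) * \<rho> n \<le> b n)
        sequentially"
      using ev_\<epsilon> ev_u[of "max 0 xp"]
    proof eventually_elim
      case (elim n)
      have "- deriv loss (u n) * \<rho> n \<le> 2 * exp (\<bar>c\<bar> + 1) * real (Suc n) powr (- \<theta>)"
        using elim up[of "u n"] neg[of "u n"] \<mu> by (intro nonsupport_term_bound[OF _ _ u]) auto
      then have "\<eta> / ?N * (- deriv loss (u n) * \<rho> n) \<le> b n"
        unfolding b_def using \<eta> by (intro mult_left_mono) auto
      then show ?case by (simp add: True)
    qed
    moreover have "\<forall>n. 0 \<le> b n" using \<eta> by (simp add: b_def)
    ultimately show ?thesis unfolding u_def \<rho>_def by blast
  next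
    case False
    then have v0: "0 < v" and \<theta>: "\<theta> = 1" and Nc: "\<eta> / ?N = v * exp c"
      using v by (auto simp: \<theta>_def c_def)
    define b where "b n = v * (2 * ((\<epsilon> n)\<^sup>2 + (1 / real (Suc n))\<^sup>2)
      + 2 * exp (\<mu>p * (\<bar>c\<bar> + 1)) * real (Suc n) powr (- 1 - \<mu>p)
      + exp (\<mu>m * (\<bar>c\<bar> + 2)) * real (Suc n) powr (- 1 - \<mu>m))" for n
    have "summable b"
      unfolding b_def using \<mu>
      by (intro summable_mult summable_add summable_Suc_powr summable_inverse_Suc_power2 sum_\<epsilon>) auto
    moreover have "eventually (\<lambda>n. (\<eta> / ?N * (- deriv loss (u n)) - v / real (Suc n)) * \<rho> n \<le> b n)
        sequentially"
      using ev_\<epsilon> ev_u[of "max xp xm"] ev_u[of "ln 4 / \<mu>m"]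
    proof eventually_elim
      case (elim n)
      have "exp (- \<mu>m * u n) \<le> exp (- ln 4)"
        using elim(3) \<mu> by (simp add: field_simps)
      then have small: "exp (- \<mu>m * u n) \<le> 1/4" by (simp add: exp_minus)
      have u': "u n = \<rho> n + ln (real (Suc n)) + c - \<epsilon> n" using u[of n] \<theta> by simp
      have *: "(exp c * (- deriv loss (u n)) - 1 / real (Suc n)) * \<rho> n
          \<le> 2 * (\<bar>\<epsilon> n\<bar> / real (Suc n)) + 2 * exp (\<mu>p * (\<bar>c\<bar> + 1)) * real (Suc n) powr (- 1 - \<mu>p)
            + exp (\<mu>m * (\<bar>c\<bar> + 2)) * real (Suc n) powr (- 1 - \<mu>m)"
        using elim up[of "u n"] lo[of "u n"] \<mu> small
        by (intro support_term_bound[OF _ _ _ u']) auto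
      \<comment> \<open>Only the squares of \<open>\<epsilon>\<close> are known to be summable, so
        the mixed error is split into two squares.\<close>
      have "\<bar>\<epsilon> n\<bar> / real (Suc n) \<le> (\<epsilon> n)\<^sup>2 + (1 / real (Suc n))\<^sup>2"
      proof -
        have "2 * (\<bar>\<epsilon> n\<bar> / real (Suc n)) \<le> (\<epsilon> n)\<^sup>2 + (1 / real (Suc n))\<^sup>2"
          using sum_squares_bound[of "\<bar>\<epsilon> n\<bar>" "1 / real (Suc n)"] by simp
        moreover have "0 \<le> \<bar>\<epsilon> n\<bar> / real (Suc n)" by simp
        ultimately show ?thesis by linarith
      qed
      then have "(exp c * (- deriv loss (u n)) - 1 / real (Suc n)) * \<rho> n
          \<le> 2 * ((\<epsilon> n)\<^sup>2 + (1 / real (Suc n))\<^sup>2)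
            + 2 * exp (\<mu>p * (\<bar>c\<bar> + 1)) * real (Suc n) powr (- 1 - \<mu>p)
            + exp (\<mu>m * (\<bar>c\<bar> + 2)) * real (Suc n) powr (- 1 - \<mu>m)"
        by (intro order_trans[OF *] add_right_mono mult_left_mono) auto
      then have "v * ((exp c * (- deriv loss (u n)) - 1 / real (Suc n)) * \<rho> n) \<le> b n"
        unfolding b_def using v0 by (intro mult_left_mono) auto
      then show ?case unfolding Nc by (simp add: algebra_simps)
    qed
    moreover have "\<forall>n. 0 \<le> b n" using v0 by (simp add: b_def)
    ultimately show ?thesis unfolding u_def \<rho>_def by blast
  qed
qed

text \<open>Expanding the squared norm of \<open>r (Suc n)\<close> leaves the per-point terms plus
  summable errors. Working with \<open>1 + (norm (r n))\<^sup>2\<close> makes additive errors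
  multiplicative, as the growth lemma expects.\<close>

lemma bounded_residual:
  assumes sep: "separable X" and h: "h = (\<Sum>i\<in>UNIV. v i *\<^sub>R X $ i)"
    and v: "\<And>i. 0 \<le> v i"
      "\<And>i. 0 < v i \<Longrightarrow> inner h (X $ i) = 1 \<and> \<eta> / real CARD('n) = v i * exp (inner wt (X $ i))"
      "\<And>i. v i = 0 \<Longrightarrow> 1 < inner h (X $ i)"
  shows "\<exists>C. \<forall>n. norm (W n - ln (real (Suc n)) *\<^sub>R h) \<le> C"
proof -
  let ?N = "real CARD('n)" and ?g = "\<lambda>n. emp_grad loss X (W n)"
  define r where "r n = Z n - ln (real (Suc n)) *\<^sub>R h - wt" for n
  define tm where "tm i n = (\<eta> / ?N * (- deriv loss (inner (W n) (X $ i))) - v i / real (Suc n))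
    * inner (r n) (X $ i)" for i n
  define lg where "lg n = ln (real (Suc (Suc n))) - ln (real (Suc n))" for n
  have "\<exists>b. summable b \<and> (\<forall>n. 0 \<le> b n) \<and> eventually (\<lambda>n. tm i n \<le> b n) sequentially" for i
    unfolding tm_def r_def by (rule inner_residual_term_bound[OF sep v])
  then obtain b where b: "\<And>i. summable (b i)" "\<And>i n. 0 \<le> b i n"
    "\<And>i. eventually (\<lambda>n. tm i n \<le> b i n) sequentially" by metis
  have r_Suc: "r (Suc n) = r n + (- \<eta> *\<^sub>R ?g n - lg n *\<^sub>R h)" for n
    by (simp add: r_def Z_Suc lg_def algebra_simps)
  \<comment> \<open>With \<open>1 / t\<close> in place of the logarithmic increment, the expansion
    of \<open>h\<close> in the data matches the gradient point by point.\<close>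
  have term_sum: "inner (r n) (- \<eta> *\<^sub>R ?g n - (1 / real (Suc n)) *\<^sub>R h) = (\<Sum>i\<in>UNIV. tm i n)" for n
  proof -
    have "- \<eta> *\<^sub>R ?g n - (1 / real (Suc n)) *\<^sub>R h
        = (\<Sum>i\<in>UNIV. (\<eta> / ?N * (- deriv loss (inner (W n) (X $ i))) - v i / real (Suc n)) *\<^sub>R X $ i)"
      unfolding h emp_grad_def
      by (simp add: scaleR_sum_right scaleR_diff_left sum_subtractf sum_negf)
    then show ?thesis by (simp add: inner_sum_right tm_def)
  qed
  \<comment> \<open>The first summand pays for that replacement, the second for the squared length
    of the step.\<close>
  define e where "e n = (norm h * (1 / real (Suc n))\<^sup>2)
      + 2 * (\<eta>\<^sup>2 * (norm (?g n))\<^sup>2 + (norm h)\<^sup>2 * (1 / real (Suc n))\<^sup>2)" for n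
  have e0: "0 \<le> e n" for n by (simp add: e_def)
  have step: "(norm (r (Suc n)))\<^sup>2 \<le> (norm (r n))\<^sup>2 + 2 * (\<Sum>i\<in>UNIV. tm i n)
      + e n * (1 + (norm (r n))\<^sup>2)" for n
  proof -
    let ?s = "- \<eta> *\<^sub>R ?g n - lg n *\<^sub>R h" and ?x = "1 / real (Suc n)"
    have lg: "0 \<le> lg n" "lg n \<le> ?x" "?x - lg n \<le> ?x\<^sup>2"
      using ln_Suc_diff_bounds[of n] by (auto simp: lg_def)
    have "(norm (r (Suc n)))\<^sup>2 = (norm (r n))\<^sup>2 + 2 * inner (r n) ?s + (norm ?s)\<^sup>2"
      unfolding r_Suc by (simp only: power2_norm_eq_inner inner_add_left inner_add_right inner_commute)
    moreover have "inner (r n) ?s = (\<Sum>i\<in>UNIV. tm i n) + (?x - lg n) * inner (r n) h"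
      unfolding term_sum[symmetric] by (simp add: inner_diff_right algebra_simps)
    moreover have "2 * ((?x - lg n) * inner (r n) h) \<le> norm h * ?x\<^sup>2 * (1 + (norm (r n))\<^sup>2)"
    proof -
      have "(?x - lg n) * inner (r n) h \<le> (?x - lg n) * (norm (r n) * norm h)"
        using lg norm_cauchy_schwarz by (intro mult_left_mono) auto
      also have "\<dots> \<le> ?x\<^sup>2 * (norm (r n) * norm h)"
        using lg by (intro mult_right_mono) auto
      finally have "2 * ((?x - lg n) * inner (r n) h) \<le> norm h * ?x\<^sup>2 * (2 * norm (r n))"
        by (simp add: mult_ac)
      also have "\<dots> \<le> norm h * ?x\<^sup>2 * (1 + (norm (r n))\<^sup>2)"
        using sum_squares_bound[of 1 "norm (r n)"] by (intro mult_left_mono) auto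
      finally show ?thesis .
    qed
    moreover have "(norm ?s)\<^sup>2 \<le> 2 * (\<eta>\<^sup>2 * (norm (?g n))\<^sup>2 + (norm h)\<^sup>2 * ?x\<^sup>2) * (1 + (norm (r n))\<^sup>2)"
    proof -
      have "norm ?s \<le> norm (- \<eta> *\<^sub>R ?g n) + norm (lg n *\<^sub>R h)" by (rule norm_triangle_ineq4)
      also have "\<dots> \<le> \<eta> * norm (?g n) + ?x * norm h"
        using lg \<eta> mult_right_mono[OF lg(2) norm_ge_zero[of h]] by simp
      finally have "(norm ?s)\<^sup>2 \<le> (\<eta> * norm (?g n) + ?x * norm h)\<^sup>2"
        by (rule power_mono) simp
      also have "\<dots> \<le> 2 * ((\<eta> * norm (?g n))\<^sup>2 + (?x * norm h)\<^sup>2)"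
        using sum_squares_bound[of "\<eta> * norm (?g n)" "?x * norm h"] by (simp add: power2_sum)
      also have "\<dots> = 2 * (\<eta>\<^sup>2 * (norm (?g n))\<^sup>2 + (norm h)\<^sup>2 * ?x\<^sup>2) * 1"
        by (simp only: power_mult_distrib mult_1_right mult.commute[of "?x\<^sup>2"])
      also have "\<dots> \<le> 2 * (\<eta>\<^sup>2 * (norm (?g n))\<^sup>2 + (norm h)\<^sup>2 * ?x\<^sup>2) * (1 + (norm (r n))\<^sup>2)"
        by (intro mult_left_mono) auto
      finally show ?thesis .
    qed
    ultimately show ?thesis by (simp add: e_def distrib_right)
  qed
  have "summable e"
    unfolding e_def by (intro summable_add summable_mult summable_grad summable_inverse_Suc_power2)
  then have sum_d: "summable (\<lambda>n. 2 * (\<Sum>i\<in>UNIV. b i n) + e n)"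
    by (intro summable_add summable_mult summable_sum b)
  have "eventually (\<lambda>n. \<forall>i. tm i n \<le> b i n) sequentially"
    using b(3) by (simp add: eventually_all_finite)
  then have ev: "eventually (\<lambda>n. 0 \<le> 2 * (\<Sum>i\<in>UNIV. b i n) + e n \<and>
      1 + (norm (r (Suc n)))\<^sup>2 \<le> (1 + (2 * (\<Sum>i\<in>UNIV. b i n) + e n)) * (1 + (norm (r n))\<^sup>2))
      sequentially"
  proof eventually_elim
    case (elim n)
    have B: "0 \<le> (\<Sum>i\<in>UNIV. b i n)" using b(2) by (simp add: sum_nonneg)
    have "(\<Sum>i\<in>UNIV. tm i n) \<le> (\<Sum>i\<in>UNIV. b i n)"
      using elim by (intro sum_mono) auto
    moreover have "0 \<le> (\<Sum>i\<in>UNIV. b i n) * (norm (r n))\<^sup>2" using B by simp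
    ultimately have "1 + (norm (r (Suc n)))\<^sup>2
        \<le> (1 + (2 * (\<Sum>i\<in>UNIV. b i n) + e n)) * (1 + (norm (r n))\<^sup>2)"
      using step[of n] by (simp add: algebra_simps)
    then show ?case using B e0[of n] by simp
  qed
  obtain C where C: "\<And>n. 1 + (norm (r n))\<^sup>2 \<le> C"
    using bounded_if_summable_growth[OF sum_d _ ev] by auto
  obtain K where K: "\<And>n. norm (M n) \<le> K"
    using convergent_imp_Bseq[of M] M_tendsto_0 by (auto simp: Bseq_def convergent_def)
  have \<kappa>: "0 \<le> \<kappa>" using \<beta> \<eta> by (simp add: \<kappa>_def)
  have "norm (W n - ln (real (Suc n)) *\<^sub>R h) \<le> C + norm wt + \<kappa> * K" for n
  proof -
    have "W n - ln (real (Suc n)) *\<^sub>R h = r n + wt + \<kappa> *\<^sub>R M n"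
      by (simp add: r_def Z_def)
    also have "norm \<dots> \<le> norm (r n) + norm wt + norm (\<kappa> *\<^sub>R M n)"
      by (meson add_right_mono norm_triangle_ineq order_trans)
    also have "norm (\<kappa> *\<^sub>R M n) \<le> \<kappa> * K"
      using K[of n] \<kappa> by (simp add: mult_left_mono)
    also have "norm (r n) \<le> C"
      using C[of n] sum_squares_bound[of 1 "norm (r n)"] zero_le_power2[of "norm (r n)"]
      by (simp add: power2_eq_square) (smt (verit) mult_left_le norm_ge_zero)
    finally show ?thesis by simp
  qed
  then show ?thesis by blast
qed

end

section \<open>Convergence of the direction and assembly\<close>

text \<open>Dividing by \<open>ln t\<close> gives convergence to \<open>h\<close>;
  \<open>sgn\<close> is continuous away from 0 and ignores the positive factor
  \<open>1 / ln t\<close>.\<close>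

lemma direction_tendsto:
  fixes w :: "nat \<Rightarrow> 'a::real_normed_vector"
  assumes bd: "\<And>t. t \<ge> 1 \<Longrightarrow> norm (w t - ln (real t) *\<^sub>R h) \<le> C" and h: "h \<noteq> 0"
  shows "(\<lambda>t. (1 / norm (w t)) *\<^sub>R w t) \<longlonglongrightarrow> (1 / norm h) *\<^sub>R h"
proof -
  have ln_top: "filterlim (\<lambda>t. ln (real t)) at_top sequentially"
    by (rule filterlim_compose[OF ln_at_top filterlim_real_sequentially])
  have "(\<lambda>t. (1 / ln (real t)) *\<^sub>R (w t - ln (real t) *\<^sub>R h)) \<longlonglongrightarrow> 0"
  proof (rule Lim_null_comparison)
    show "eventually (\<lambda>t. norm ((1 / ln (real t)) *\<^sub>R (w t - ln (real t) *\<^sub>R h)) \<le> C / ln (real t))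
        sequentially"
      using eventually_ge_at_top[of 1]
    proof eventually_elim
      case (elim t)
      then show ?case using bd[of t] by (simp add: divide_right_mono)
    qed
    show "(\<lambda>t. C / ln (real t)) \<longlonglongrightarrow> 0"
      by (intro tendsto_divide_0[OF tendsto_const] filterlim_at_top_imp_at_infinity ln_top)
  qed
  then have "(\<lambda>t. h + (1 / ln (real t)) *\<^sub>R (w t - ln (real t) *\<^sub>R h)) \<longlonglongrightarrow> h + 0"
    by (intro tendsto_add tendsto_const)
  then have "(\<lambda>t. sgn (h + (1 / ln (real t)) *\<^sub>R (w t - ln (real t) *\<^sub>R h))) \<longlonglongrightarrow> sgn h"
    using h by (intro tendsto_sgn) auto
  moreover have "eventually (\<lambda>t. sgn (h + (1 / ln (real t)) *\<^sub>R (w t - ln (real t) *\<^sub>R h))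
      = (1 / norm (w t)) *\<^sub>R w t) sequentially"
    using eventually_gt_at_top[of 1]
  proof eventually_elim
    case (elim t)
    then have pos: "0 < ln (real t)" by simp
    then have "h + (1 / ln (real t)) *\<^sub>R (w t - ln (real t) *\<^sub>R h) = (1 / ln (real t)) *\<^sub>R w t"
      by (simp add: scaleR_diff_right)
    then show ?case using pos by (simp add: sgn_scaleR sgn_div_norm inverse_eq_divide)
  qed
  ultimately have "(\<lambda>t. (1 / norm (w t)) *\<^sub>R w t) \<longlonglongrightarrow> sgn h"
    by (rule Lim_transform_eventually)
  then show ?thesis by (simp add: sgn_div_norm inverse_eq_divide)
qed

theorem theorem2:
  fixes loss :: "real \<Rightarrow> real" and \<beta> \<eta> :: real
  assumes A2: "exp_tail_loss loss"
    and A3: "locally_smooth_loss loss"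
    and beta: "0 \<le> \<beta>" "\<beta> < 1"
  shows "AE X in (lborel :: ((real^'d)^'n) measure).
           separable X \<longrightarrow>
           (\<forall>(w :: nat \<Rightarrow> real^'d) (m :: nat \<Rightarrow> real^'d).
              m 0 = 0 \<longrightarrow>
              (\<forall>t\<ge>1. m t = \<beta> *\<^sub>R m (t - 1) + (1 - \<beta>) *\<^sub>R emp_grad loss X (w t)) \<longrightarrow>
              (\<forall>t\<ge>1. w (t + 1) = w t - \<eta> *\<^sub>R m t) \<longrightarrow>
              0 < \<eta> \<longrightarrow>
              \<eta> < 2 * real CARD('n) /
                    ((sigma_max X)^2 *
                     smooth_const loss (the_inv loss (real CARD('n) * emp_loss loss X (w 1)))) \<longrightarrow>
              (\<exists>C. \<forall>t\<ge>1. norm (w t - ln (real t) *\<^sub>R max_margin X) \<le> C) \<and>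
              ((\<lambda>t. (1 / norm (w t)) *\<^sub>R w t) \<longlonglongrightarrow>
                 (1 / norm (max_margin X)) *\<^sub>R max_margin X))"
  \<comment> \<open>Degeneracy speaks of the data alone, so one null set serves all
    initializations.\<close>
  using AE_not_degenerate
proof (rule AE_mp, intro AE_I2 impI allI)
  fix X :: "(real^'d)^'n" and w m :: "nat \<Rightarrow> real^'d"
  let ?N = "real CARD('n)"
  define s0 where "s0 = the_inv loss (?N * emp_loss loss X (w 1))"
  assume nd: "\<not> degenerate X" and sep: "separable X" and m0: "m 0 = 0"
    and m: "\<forall>t\<ge>1. m t = \<beta> *\<^sub>R m (t - 1) + (1 - \<beta>) *\<^sub>R emp_grad loss X (w t)"
    and w: "\<forall>t\<ge>1. w (t + 1) = w t - \<eta> *\<^sub>R m t"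
    and \<eta>: "0 < \<eta>" "\<eta> < 2 * ?N / ((sigma_max X)\<^sup>2 *
        smooth_const loss (the_inv loss (?N * emp_loss loss X (w 1))))"
  obtain H where H: "H-lipschitz_on {s0..} (deriv loss)" "\<eta> * ((sigma_max X)\<^sup>2 * H) < 2 * ?N"
    using smooth_const_lipschitzE[OF A3 \<eta>] by (auto simp: s0_def)
  \<comment> \<open>Places \<open>N * L(w(1))\<close> in the range of the loss, so that
    \<open>s0\<close> is a genuine preimage.\<close>
  have "loss (inner (w 1) (X $ i)) \<le> ?N * emp_loss loss X (w 1)" for i
    using member_le_sum[of i UNIV "\<lambda>i. loss (inner (w 1) (X $ i))"] exp_tail_loss_pos[OF A2]
    by (simp add: emp_loss_def less_imp_le)
  then have s0: "loss s0 = ?N * emp_loss loss X (w 1)"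
    unfolding s0_def by (rule exp_tail_loss_the_inv[OF A2])
  \<comment> \<open>The shift discards \<open>w 0\<close>, about which nothing is assumed.\<close>
  interpret gdm_run loss X \<beta> \<eta> s0 H "\<lambda>n. w (Suc n)" m
  proof
    fix n
    show "m (Suc n) = \<beta> *\<^sub>R m n + (1 - \<beta>) *\<^sub>R emp_grad loss X (w (Suc n))"
      using m[rule_format, of "Suc n"] by simp
    show "w (Suc (Suc n)) = w (Suc n) - \<eta> *\<^sub>R m (Suc n)"
      using w[rule_format, of "Suc n"] by simp
  qed (use A2 H beta \<eta>(1) s0 m0 in auto)
  obtain a where a: "a \<in> prob_simplex" and p0: "point_comb X a \<noteq> 0"
    and ge: "\<And>i. (norm (point_comb X a))\<^sup>2 \<le> inner (point_comb X a) (X $ i)"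
    and eq: "\<And>i. a $ i \<noteq> 0 \<Longrightarrow> inner (point_comb X a) (X $ i) = (norm (point_comb X a))\<^sup>2"
    using separable_min_norm_point[OF sep] by blast
  define p where "p = point_comb X a"
  define v where "v i = a $ i / (norm p)\<^sup>2" for i
  have h: "max_margin X = (1 / (norm p)\<^sup>2) *\<^sub>R p"
    unfolding p_def by (rule max_margin_eq[OF a p0 ge])
  \<comment> \<open>The logarithm solves \<open>(\<eta> / N) * exp (- inner wt x_i) = v i\<close> on
    the support vectors.\<close>
  obtain wt where wt: "\<And>i. a $ i \<noteq> 0 \<Longrightarrow> inner wt (X $ i) = ln (\<eta> / ?N / v i)"
    using not_degenerate_solve[OF nd a p0 eq, of "\<lambda>i. ln (\<eta> / ?N / v i)"] by blast
  have pp: "0 < (norm p)\<^sup>2" using p0 by (simp add: p_def)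
  have a0: "0 \<le> a $ i" for i using a by (simp add: prob_simplex_def)
  have "\<exists>C. \<forall>n. norm (w (Suc n) - ln (real (Suc n)) *\<^sub>R max_margin X) \<le> C"
  proof (rule bounded_residual[OF sep, where v = v and wt = wt])
    show "max_margin X = (\<Sum>i\<in>UNIV. v i *\<^sub>R X $ i)"
      by (simp add: h v_def p_def point_comb_def scaleR_sum_right)
    show "0 \<le> v i" for i using a0 by (simp add: v_def)
    show "inner (max_margin X) (X $ i) = 1 \<and> \<eta> / ?N = v i * exp (inner wt (X $ i))" if "0 < v i" for i
    proof -
      have "a $ i \<noteq> 0" using that by (auto simp: v_def)
      then show ?thesis
        using wt[of i] eq[of i] that \<eta>(1) pp by (simp add: h p_def)
    qed
    show "1 < inner (max_margin X) (X $ i)" if "v i = 0" for i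
    proof -
      have "a $ i = 0" using that pp by (simp add: v_def)
      then have "(norm p)\<^sup>2 < inner p (X $ i)"
        using not_degenerate_support[OF nd a p0 eq, of i] ge[of i] by (simp add: p_def less_le)
      then show ?thesis using pp by (simp add: h field_simps)
    qed
  qed
  then obtain C where C: "\<And>n. norm (w (Suc n) - ln (real (Suc n)) *\<^sub>R max_margin X) \<le> C"
    by blast
  have bd: "norm (w t - ln (real t) *\<^sub>R max_margin X) \<le> C" if "t \<ge> 1" for t
    using C[of "t - 1"] that by simp
  have "max_margin X \<noteq> 0" using pp by (auto simp: h)
  with bd show "(\<exists>C. \<forall>t\<ge>1. norm (w t - ln (real t) *\<^sub>R max_margin X) \<le> C) \<and>
      ((\<lambda>t. (1 / norm (w t)) *\<^sub>R w t) \<longlonglongrightarrow>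
        (1 / norm (max_margin X)) *\<^sub>R max_margin X)"
    by (blast intro: direction_tendsto)
qed

end
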